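(* Let $d,m\ge 1$ be integers and $T>0$, $M>0$. Let $f:\mathbb R^d\times[0,T]\to\mathbb R^d$ and $G:\mathbb R^d\times[0,T]\to\mathbb R^{d\times m}$ be continuous in $t$ and such that there are constants $L_f,L_G>0$ with $$\|f(x,t)-f(y,t)\|\le L_f\|x-y\|,\qquad \|G(x,t)-G(y,t)\|\le L_G\|x-y\|\qquad\text{for all }x,y\in\mathbb R^d,\ t\in[0,T].$$ Let $K\subset\mathbb R^d$ be compact and let $\mathcal U_M=\{u\in L^\infty(0,T;\mathbb R^m):\|u\|_{L^\infty}\le M\}$. For $z_0\in\mathbb R^d$ and $u\in\mathcal U_M$ let $z_{z_0,u}$ be the solution of $$\dot z(t)=f(z(t),t)+G(z(t),t)u(t),\qquad z(0)=z_0 .$$ Then for every $\varepsilon>0$ there exist integers $P,Q\ge1$ and SA-NODE parameters $(\Theta,\Phi)$ of widths $(P,Q)$ such that, for every $z_0\in K$ and every $u\in\mathcal U_M$, the solution $y_{z_0,u}$ of the controlled SA-NODE $$\dot y(t)=f_\Theta(y(t),t)+G_\Phi(y(t),t)u(t),\qquad y(0)=z_0,$$ satisfies $$\sup_{t\in[0,T]}\|z_{z_0,u}(t)-y_{z_0,u}(t)\|\le\varepsilon .$$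
   Context: Vectors carry the Euclidean norm; matrices in $\mathbb R^{d\times m}$ carry the operator norm induced by the Euclidean norms on $\mathbb R^m$ and $\mathbb R^d$. Solutions of ODEs with controls $u\in L^\infty$ are absolutely continuous functions on $[0,T]$ satisfying the equation for almost every $t$ (they exist uniquely under the stated Lipschitz hypotheses). $\sigma(s)=\max\{s,0\}$ is the ReLU function and $\boldsymbol\sigma(x)=(\sigma(x_1),\dots,\sigma(x_d))$ for $x\in\mathbb R^d$. SA-NODE parameters of widths $(P,Q)$ are time-independent: $\Theta=(W_i,A_i^1,A_i^2,B_i)_{i=1}^P$ with $W_i\in\mathbb R^d$, $A_i^1\in\mathbb R^{d\times d}$, $A_i^2\in\mathbb R^d$, $B_i\in\mathbb R^d$, and $\Phi=(\widetilde W_j,\widetilde A_j^1,\widetilde A_j^2,\widetilde B_j)_{j=1}^Q$ with $\widetilde W_j\in\mathbb R^{d\times m}$, $\widetilde A_j^1\in\mathbb R^{d\times d}$, $\widetilde A_j^2\in\mathbb R^d$, $\widetilde B_j\in\mathbb R^d$. The associated networks are $$f_\Theta(y,t)=\sum_{i=1}^P W_i\circ\boldsymbol\sigma(A_i^1y+A_i^2t+B_i)\in\mathbb R^d,\qquad G_\Phi(y,t)=\sum_{j=1}^Q\widetilde W_j\circ\boldsymbol\sigma(\widetilde A_j^1y+\widetilde A_j^2t+\widetilde B_j)\in\mathbb R^{d\times m}.$$ For vectors $v,w\in\mathbb R^d$, $v\circ w$ is the entrywise (Hadamard) product; for a matrix $W\in\mathbb R^{d\times m}$ and a vector $v\in\mathbb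 R^d$, $W\circ v\in\mathbb R^{d\times m}$ is the row-wise product $(W\circ v)_{k\ell}=W_{k\ell}v_k$. *)

theory Defs
  imports "HOL-Analysis.Analysis" "HOL-Probability.Essential_Supremum"
begin

definition relu :: "real \<Rightarrow> real" where
  "relu s = max s 0"

definition relu_vec :: "real ^ 'd \<Rightarrow> real ^ 'd" where
  "relu_vec x = (\<chi> k. relu (x $ k))"

definition hadamard :: "real ^ 'd \<Rightarrow> real ^ 'd \<Rightarrow> real ^ 'd" where
  "hadamard v w = (\<chi> k. v $ k * w $ k)"

definition row_hadamard :: "real ^ 'm ^ 'd \<Rightarrow> real ^ 'd \<Rightarrow> real ^ 'm ^ 'd" where
  "row_hadamard W v = (\<chi> k l. W $ k $ l * v $ k)"

text \<open>The parameters of a network of width P are families indexed by the naturals, of which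
  only the entries with index below P are used.\<close>

definition sa_drift ::
  "nat \<Rightarrow> (nat \<Rightarrow> real ^ 'd) \<Rightarrow> (nat \<Rightarrow> real ^ 'd ^ 'd) \<Rightarrow> (nat \<Rightarrow> real ^ 'd) \<Rightarrow> (nat \<Rightarrow> real ^ 'd)
    \<Rightarrow> real ^ 'd \<Rightarrow> real \<Rightarrow> real ^ 'd" where
  "sa_drift P W A1 A2 B y t =
     (\<Sum>i<P. hadamard (W i) (relu_vec (A1 i *v y + t *\<^sub>R A2 i + B i)))"

definition sa_control ::
  "nat \<Rightarrow> (nat \<Rightarrow> real ^ 'm ^ 'd) \<Rightarrow> (nat \<Rightarrow> real ^ 'd ^ 'd) \<Rightarrow> (nat \<Rightarrow> real ^ 'd) \<Rightarrow> (nat \<Rightarrow> real ^ 'd)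
    \<Rightarrow> real ^ 'd \<Rightarrow> real \<Rightarrow> real ^ 'm ^ 'd" where
  "sa_control Q W A1 A2 B y t =
     (\<Sum>j<Q. row_hadamard (W j) (relu_vec (A1 j *v y + t *\<^sub>R A2 j + B j)))"

text \<open>The library norm on matrices is the Frobenius norm, hence this separate definition.\<close>

definition op_norm :: "real ^ 'm ^ 'd \<Rightarrow> real" where
  "op_norm A = onorm (\<lambda>v. A *v v)"

text \<open>Absolute continuity of a function on an interval; the library constant
  absolutely_continuous is about measures.\<close>

definition abs_continuous_on :: "real \<Rightarrow> real \<Rightarrow> (real \<Rightarrow> 'a::real_normed_vector) \<Rightarrow> bool" where
  "abs_continuous_on a b z \<longleftrightarrow>
     (\<forall>\<epsilon>>0. \<exists>\<delta>>0. \<forall>(n::nat) (l::nat \<Rightarrow> real) (r::nat \<Rightarrow> real).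
        (\<forall>i<n. a \<le> l i \<and> l i \<le> r i \<and> r i \<le> b) \<longrightarrow>
        (\<forall>i<n. \<forall>j<n. i \<noteq> j \<longrightarrow> {l i<..<r i} \<inter> {l j<..<r j} = {}) \<longrightarrow>
        (\<Sum>i<n. r i - l i) < \<delta> \<longrightarrow>
        (\<Sum>i<n. norm (z (r i) - z (l i))) < \<epsilon>)"

text \<open>Controls are represented by functions rather than by classes modulo null sets; values
  outside the interval are irrelevant.\<close>

definition admissible_controls :: "real \<Rightarrow> real \<Rightarrow> (real \<Rightarrow> real ^ 'm) set" where
  "admissible_controls T M =
     {u. u \<in> borel_measurable (lebesgue_on {0..T}) \<and>
         esssup (lebesgue_on {0..T}) (\<lambda>t. ereal (norm (u t))) \<le> ereal M}"

definition is_solution ::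
  "(real ^ 'd \<Rightarrow> real \<Rightarrow> real ^ 'd) \<Rightarrow> (real ^ 'd \<Rightarrow> real \<Rightarrow> real ^ 'm ^ 'd) \<Rightarrow> real
    \<Rightarrow> (real \<Rightarrow> real ^ 'm) \<Rightarrow> real ^ 'd \<Rightarrow> (real \<Rightarrow> real ^ 'd) \<Rightarrow> bool" where
  "is_solution f G T u z0 z \<longleftrightarrow>
     abs_continuous_on 0 T z \<and> z 0 = z0 \<and>
     (AE t in lebesgue_on {0..T}.
        (z has_vector_derivative f (z t) t + G (z t) t *v u t) (at t within {0..T}))"

end

theory Submission
  imports Defs
begin

text \<open>
  Gronwall's inequality for absolutely continuous functions rests on a mean value estimate with an
  exceptional null set: cover the null set by an open set of small measure and take a tagged
  division of the interval subordinate to it; absolute continuity controls the increments over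
  the intervals tagged in the null set, the derivative those over the others.

  All solutions of the given system starting in K stay in one ball of radius R, since f and G grow
  at most linearly and the controls are bounded. Sums of exponential functions are dense by
  Stone-Weierstrass, and the exponential is a uniform limit of piecewise linear functions, so on
  the ball of radius R + 1 the fields f and G are approximated up to \<delta> by ReLU networks. As long
  as the network solution stays in that larger ball, Gronwall bounds its distance from the given
  solution by a multiple of \<delta>; for small \<delta> this is below 1, so it never leaves.
\<close>

section \<open>Absolutely continuous functions and Gronwall's inequality\<close>

text \<open>The definition numbers the intervals by an initial segment of the naturals. Below they
  are the cells of a tagged division, indexed by pairs of a tag and a set, so the condition is
  transported along a bijection to an arbitrary finite index set.\<close>

lemma abs_continuous_on_finite_family:
  fixes z :: "real \<Rightarrow> 'a::real_normed_vector"
  assumes "abs_continuous_on a b z" "e > 0"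
  shows "\<exists>d>0. \<forall>I l r. finite I \<longrightarrow> (\<forall>i\<in>I. a \<le> l i \<and> l i \<le> r i \<and> r i \<le> b) \<longrightarrow>
       (\<forall>i\<in>I. \<forall>j\<in>I. i \<noteq> j \<longrightarrow> {l i<..<r i} \<inter> {l j<..<r j} = {}) \<longrightarrow>
       (\<Sum>i\<in>I. r i - l i) < d \<longrightarrow> (\<Sum>i\<in>I. norm (z (r i) - z (l i))) < e"
proof -
  obtain d where "d > 0" and d: "\<forall>(n::nat) l r. (\<forall>i<n. a \<le> l i \<and> l i \<le> r i \<and> r i \<le> b) \<longrightarrow>
      (\<forall>i<n. \<forall>j<n. i \<noteq> j \<longrightarrow> {l i<..<r i} \<inter> {l j<..<r j} = {}) \<longrightarrow>
      (\<Sum>i<n. r i - l i) < d \<longrightarrow> (\<Sum>i<n. norm (z (r i) - z (l i))) < e"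
    using assms(1)[unfolded abs_continuous_on_def, rule_format, OF assms(2)] by blast
  show ?thesis
  proof (intro exI[of _ d] conjI allI impI)
    fix I :: "'b set" and l r
    assume fin: "finite I"
      and ord: "\<forall>i\<in>I. a \<le> l i \<and> l i \<le> r i \<and> r i \<le> b"
      and disj: "\<forall>i\<in>I. \<forall>j\<in>I. i \<noteq> j \<longrightarrow> {l i<..<r i} \<inter> {l j<..<r j} = {}"
      and small: "(\<Sum>i\<in>I. r i - l i) < d"
    obtain h where h: "bij_betw h {..<card I} I"
      using ex_bij_betw_nat_finite[OF fin] by (auto simp: lessThan_atLeast0)
    have inI: "h i \<in> I" if "i < card I" for i
      using h that by (auto simp: bij_betw_def)
    have inj: "h i \<noteq> h j" if "i < card I" "j < card I" "i \<noteq> j" for i j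
      using h that by (auto simp: bij_betw_def inj_on_def)
    have "(\<Sum>i<card I. norm (z (r (h i)) - z (l (h i)))) < e"
    proof (rule d[rule_format])
      show "(\<Sum>i<card I. r (h i) - l (h i)) < d"
        using small sum.reindex_bij_betw[OF h, of "\<lambda>i. r i - l i"] by simp
    qed (use inI inj ord disj in auto)
    then show "(\<Sum>i\<in>I. norm (z (r i) - z (l i))) < e"
      using sum.reindex_bij_betw[OF h, of "\<lambda>i. norm (z (r i) - z (l i))"] by simp
  qed (rule \<open>d > 0\<close>)
qed

lemma abs_continuous_on_subinterval:
  assumes "abs_continuous_on a b z" "a \<le> c" "d \<le> b"
  shows "abs_continuous_on c d z"
  unfolding abs_continuous_on_def
proof (intro allI impI)
  fix e :: real assume "e > 0"
  obtain \<delta> where "\<delta> > 0" and \<delta>: "\<forall>(n::nat) l r. (\<forall>i<n. a \<le> l i \<and> l i \<le> r i \<and> r i \<le> b) \<longrightarrow>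
      (\<forall>i<n. \<forall>j<n. i \<noteq> j \<longrightarrow> {l i<..<r i} \<inter> {l j<..<r j} = {}) \<longrightarrow>
      (\<Sum>i<n. r i - l i) < \<delta> \<longrightarrow> (\<Sum>i<n. norm (z (r i) - z (l i))) < e"
    using assms(1)[unfolded abs_continuous_on_def, rule_format, OF \<open>e > 0\<close>] by blast
  show "\<exists>\<delta>>0. \<forall>(n::nat) l r. (\<forall>i<n. c \<le> l i \<and> l i \<le> r i \<and> r i \<le> d) \<longrightarrow>
      (\<forall>i<n. \<forall>j<n. i \<noteq> j \<longrightarrow> {l i<..<r i} \<inter> {l j<..<r j} = {}) \<longrightarrow>
      (\<Sum>i<n. r i - l i) < \<delta> \<longrightarrow> (\<Sum>i<n. norm (z (r i) - z (l i))) < e"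
  proof (intro exI[of _ \<delta>] conjI allI impI)
    fix n :: nat and l r
    assume "\<forall>i<n. c \<le> l i \<and> l i \<le> r i \<and> r i \<le> d"
      and *: "\<forall>i<n. \<forall>j<n. i \<noteq> j \<longrightarrow> {l i<..<r i} \<inter> {l j<..<r j} = {}"
      "(\<Sum>i<n. r i - l i) < \<delta>"
    then have "\<forall>i<n. a \<le> l i \<and> l i \<le> r i \<and> r i \<le> b"
      using assms(2,3) by force
    then show "(\<Sum>i<n. norm (z (r i) - z (l i))) < e"
      using \<delta>[THEN spec, THEN spec, THEN spec, of n l r] * by blast
  qed (rule \<open>\<delta> > 0\<close>)
qed

lemma abs_continuous_on_diff:
  fixes z y :: "real \<Rightarrow> 'a::real_normed_vector"
  assumes "abs_continuous_on a b z" "abs_continuous_on a b y"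
  shows "abs_continuous_on a b (\<lambda>t. z t - y t)"
  unfolding abs_continuous_on_def
proof (intro allI impI)
  have diff_swap: "norm (z p - y p - (z q - y q)) \<le> norm (z p - z q) + norm (y p - y q)" for p q
    using norm_triangle_ineq4[of "z p - z q" "y p - y q"] by (simp add: algebra_simps)
  fix e :: real assume "e > 0"
  then have e2: "e/2 > 0" by simp
  obtain d1 where "d1 > 0" and d1: "\<forall>(n::nat) l r. (\<forall>i<n. a \<le> l i \<and> l i \<le> r i \<and> r i \<le> b) \<longrightarrow>
      (\<forall>i<n. \<forall>j<n. i \<noteq> j \<longrightarrow> {l i<..<r i} \<inter> {l j<..<r j} = {}) \<longrightarrow>
      (\<Sum>i<n. r i - l i) < d1 \<longrightarrow> (\<Sum>i<n. norm (z (r i) - z (l i))) < e/2"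
    using assms(1)[unfolded abs_continuous_on_def, rule_format, OF e2] by blast
  obtain d2 where "d2 > 0" and d2: "\<forall>(n::nat) l r. (\<forall>i<n. a \<le> l i \<and> l i \<le> r i \<and> r i \<le> b) \<longrightarrow>
      (\<forall>i<n. \<forall>j<n. i \<noteq> j \<longrightarrow> {l i<..<r i} \<inter> {l j<..<r j} = {}) \<longrightarrow>
      (\<Sum>i<n. r i - l i) < d2 \<longrightarrow> (\<Sum>i<n. norm (y (r i) - y (l i))) < e/2"
    using assms(2)[unfolded abs_continuous_on_def, rule_format, OF e2] by blast
  show "\<exists>\<delta>>0. \<forall>(n::nat) l r. (\<forall>i<n. a \<le> l i \<and> l i \<le> r i \<and> r i \<le> b) \<longrightarrow>
      (\<forall>i<n. \<forall>j<n. i \<noteq> j \<longrightarrow> {l i<..<r i} \<inter> {l j<..<r j} = {}) \<longrightarrow>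
      (\<Sum>i<n. r i - l i) < \<delta> \<longrightarrow>
      (\<Sum>i<n. norm (z (r i) - y (r i) - (z (l i) - y (l i)))) < e"
  proof (intro exI[of _ "min d1 d2"] conjI allI impI)
    fix n :: nat and l r
    assume *: "\<forall>i<n. a \<le> l i \<and> l i \<le> r i \<and> r i \<le> b"
      "\<forall>i<n. \<forall>j<n. i \<noteq> j \<longrightarrow> {l i<..<r i} \<inter> {l j<..<r j} = {}"
      and small: "(\<Sum>i<n. r i - l i) < min d1 d2"
    have "(\<Sum>i<n. norm (z (r i) - y (r i) - (z (l i) - y (l i))))
      \<le> (\<Sum>i<n. norm (z (r i) - z (l i)) + norm (y (r i) - y (l i)))"
      by (intro sum_mono diff_swap)
    also have "\<dots> = (\<Sum>i<n. norm (z (r i) - z (l i))) + (\<Sum>i<n. norm (y (r i) - y (l i)))"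
      by (rule sum.distrib)
    also have "\<dots> < e/2 + e/2"
    proof (rule add_strict_mono)
      show "(\<Sum>i<n. norm (z (r i) - z (l i))) < e/2"
        using d1[THEN spec, THEN spec, THEN spec, of n l r] * small by simp
      show "(\<Sum>i<n. norm (y (r i) - y (l i))) < e/2"
        using d2[THEN spec, THEN spec, THEN spec, of n l r] * small by simp
    qed
    finally show "(\<Sum>i<n. norm (z (r i) - y (r i) - (z (l i) - y (l i)))) < e" by simp
  qed (use \<open>d1 > 0\<close> \<open>d2 > 0\<close> in auto)
qed

lemma abs_continuous_on_imp_continuous_on:
  fixes z :: "real \<Rightarrow> 'a::real_normed_vector"
  assumes "abs_continuous_on a b z"
  shows "continuous_on {a..b} z"
  unfolding continuous_on_iff
proof (intro ballI allI impI)
  fix x e :: real assume x: "x \<in> {a..b}" and "e > 0"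
  obtain d where "d > 0" and d: "\<forall>(n::nat) l r. (\<forall>i<n. a \<le> l i \<and> l i \<le> r i \<and> r i \<le> b) \<longrightarrow>
      (\<forall>i<n. \<forall>j<n. i \<noteq> j \<longrightarrow> {l i<..<r i} \<inter> {l j<..<r j} = {}) \<longrightarrow>
      (\<Sum>i<n. r i - l i) < d \<longrightarrow> (\<Sum>i<n. norm (z (r i) - z (l i))) < e"
    using assms[unfolded abs_continuous_on_def, rule_format, OF \<open>e > 0\<close>] by blast
  have "dist (z y) (z x) < e" if "y \<in> {a..b}" "dist y x < d" for y
    \<comment> \<open>A family consisting of one interval suffices; \<open>min\<close> and
      \<open>max\<close> put its endpoints in order.\<close>
    using d[THEN spec, THEN spec, THEN spec, of 1 "\<lambda>_. min x y" "\<lambda>_. max x y"] x that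
    by (auto simp: dist_norm min_def max_def norm_minus_commute split: if_splits)
  with \<open>d > 0\<close> show "\<exists>d>0. \<forall>y\<in>{a..b}. dist y x < d \<longrightarrow> dist (z y) (z x) < e" by blast
qed

text \<open>The straddle lemma of Henstock integration. Since \<open>t\<close> lies between
  \<open>l\<close> and \<open>r\<close>, the two one-sided errors add up to exactly
  \<open>e * (r - l)\<close>; endpoints on the same side of \<open>t\<close> would give no such
  bound.\<close>

lemma has_vector_derivative_straddle:
  assumes "(f has_vector_derivative f') (at t within S)" "e > 0"
  obtains d where "d > 0"
    "\<And>l r. l \<in> S \<Longrightarrow> r \<in> S \<Longrightarrow> l \<le> t \<Longrightarrow> t \<le> r \<Longrightarrow> t - l < d \<Longrightarrow> r - t < d
       \<Longrightarrow> norm (f r - f l - (r - l) *\<^sub>R f') \<le> e * (r - l)"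
proof -
  obtain d where "d > 0"
    and d: "\<And>y. y \<in> S \<Longrightarrow> norm (y - t) < d \<Longrightarrow> norm (f y - f t - (y - t) *\<^sub>R f') \<le> e * norm (y - t)"
    using assms(1)[unfolded has_vector_derivative_def has_derivative_within_alt] assms(2) by blast
  show thesis
  proof (rule that[OF \<open>d > 0\<close>])
    fix l r assume lr: "l \<in> S" "r \<in> S" "l \<le> t" "t \<le> r" "t - l < d" "r - t < d"
    have "f r - f l - (r - l) *\<^sub>R f' = (f r - f t - (r - t) *\<^sub>R f') - (f l - f t - (l - t) *\<^sub>R f')"
      by (simp add: algebra_simps)
    then have "norm (f r - f l - (r - l) *\<^sub>R f')
      \<le> norm (f r - f t - (r - t) *\<^sub>R f') + norm (f l - f t - (l - t) *\<^sub>R f')"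
      by (metis norm_triangle_ineq4)
    also have "\<dots> \<le> e * (r - t) + e * (t - l)"
      using d[of r] d[of l] lr by (intro add_mono) auto
    finally show "norm (f r - f l - (r - l) *\<^sub>R f') \<le> e * (r - l)"
      by (simp add: algebra_simps)
  qed
qed

text \<open>The bound on the speed of \<open>w\<close> is expressed through a primitive
  \<open>F\<close>, so both sides are increments and telescope over a division. As \<open>F'\<close>
  is nonnegative, \<open>F\<close> is increasing, and the cells tagged in \<open>N\<close> can be
  included on the right at no cost.\<close>

lemma abs_continuous_on_norm_diff_le:
  fixes w :: "real \<Rightarrow> 'a::real_normed_vector" and F F' :: "real \<Rightarrow> real"
  assumes ab: "a \<le> b" and ac: "abs_continuous_on a b w" and N: "negligible N"
    and F: "\<And>t. t \<in> {a..b} \<Longrightarrow> (F has_vector_derivative F' t) (at t within {a..b})"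
    and F'_nonneg: "\<And>t. t \<in> {a..b} \<Longrightarrow> F' t \<ge> 0"
    and w: "\<And>t. t \<in> {a..b} - N \<Longrightarrow>
              \<exists>w'. (w has_vector_derivative w') (at t within {a..b}) \<and> norm w' \<le> F' t"
  shows "norm (w b - w a) \<le> F b - F a"
proof -
  have F_mono: "F l \<le> F r" if lr: "a \<le> l" "l \<le> r" "r \<le> b" for l r
  proof -
    have "\<exists>x\<in>{l..r}. F r - F l = (\<lambda>h. h *\<^sub>R F' x) (r - l)"
    proof (rule mvt_very_simple[OF lr(2)])
      fix x assume "l \<le> x" "x \<le> r"
      then show "(F has_derivative (\<lambda>h. h *\<^sub>R F' x)) (at x within {l..r})"
        using F[of x] lr unfolding has_vector_derivative_def
        by (auto intro: has_derivative_subset)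
    qed
    then obtain x where "x \<in> {l..r}" "F r - F l = (r - l) * F' x" by auto
    moreover from this have "F' x \<ge> 0" using F'_nonneg[of x] lr by auto
    ultimately show ?thesis using lr mult_nonneg_nonneg[of "r - l" "F' x"] by linarith
  qed
  have "norm (w b - w a) \<le> F b - F a + e" if "e > 0" for e
  proof -
    have e2: "e/2 > 0" using that by simp
    \<comment> \<open>An extra slope \<open>c\<close> costs at most \<open>e/2\<close> over the
      whole interval; the summand 1 keeps the denominator positive when
      \<open>a = b\<close>.\<close>
    define c where "c = e / (2 * (b - a + 1))"
    have "c > 0" using that ab by (simp add: c_def)
    have "c * (b - a) \<le> c * (b - a + 1)"
      using \<open>c > 0\<close> by (intro mult_left_mono) auto
    also have "\<dots> = e/2"
      using ab by (simp add: c_def field_simps)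
    finally have c_le: "c * (b - a) \<le> e/2" .
    \<comment> \<open>Near a point off \<open>N\<close>, both increments are compared with their
      derivatives at the point; each comparison uses up half of the slope \<open>c\<close>.\<close>
    have good: "\<exists>d>0. \<forall>l r. a \<le> l \<longrightarrow> l \<le> t \<longrightarrow> t \<le> r \<longrightarrow> r \<le> b \<longrightarrow> t - l < d \<longrightarrow> r - t < d \<longrightarrow>
        norm (w r - w l) \<le> F r - F l + c * (r - l)" if t: "t \<in> {a..b} - N" for t
    proof -
      obtain w' where w': "(w has_vector_derivative w') (at t within {a..b})" "norm w' \<le> F' t"
        using w[OF t] by blast
      have c2: "c/2 > 0" using \<open>c > 0\<close> by simp
      obtain d1 where "d1 > 0" and d1: "\<And>l r. \<lbrakk>l \<in> {a..b}; r \<in> {a..b}; l \<le> t; t \<le> r; t - l < d1; r - t < d1\<rbrakk>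
          \<Longrightarrow> norm (w r - w l - (r - l) *\<^sub>R w') \<le> c/2 * (r - l)"
        by (rule has_vector_derivative_straddle[OF w'(1) c2]) blast
      have "t \<in> {a..b}" using t by blast
      obtain d2 where "d2 > 0" and d2: "\<And>l r. \<lbrakk>l \<in> {a..b}; r \<in> {a..b}; l \<le> t; t \<le> r; t - l < d2; r - t < d2\<rbrakk>
          \<Longrightarrow> norm (F r - F l - (r - l) *\<^sub>R F' t) \<le> c/2 * (r - l)"
        by (rule has_vector_derivative_straddle[OF F[OF \<open>t \<in> {a..b}\<close>] c2]) blast
      show ?thesis
      proof (intro exI[of _ "min d1 d2"] conjI allI impI)
        fix l r assume lr: "a \<le> l" "l \<le> t" "t \<le> r" "r \<le> b" "t - l < min d1 d2" "r - t < min d1 d2"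
        have "norm (w r - w l) \<le> norm (w r - w l - (r - l) *\<^sub>R w') + norm ((r - l) *\<^sub>R w')"
          by (metis diff_add_cancel norm_triangle_ineq)
        also have "\<dots> \<le> c/2 * (r - l) + (r - l) * F' t"
          using d1[of l r] lr w'(2) by (intro add_mono) (auto intro: mult_left_mono)
        also have "\<dots> \<le> F r - F l + c * (r - l)"
        proof -
          have "\<bar>F r - F l - (r - l) * F' t\<bar> \<le> c/2 * (r - l)"
            using d2[of l r] lr by simp
          then have "(r - l) * F' t - (F r - F l) \<le> c/2 * (r - l)" by linarith
          moreover have "c/2 * (r - l) + c/2 * (r - l) = c * (r - l)" by simp
          ultimately show ?thesis by linarith
        qed
        finally show "norm (w r - w l) \<le> F r - F l + c * (r - l)" .
      qed (use \<open>d1 > 0\<close> \<open>d2 > 0\<close> in auto)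
    qed
    then obtain d where d: "\<And>t. t \<in> {a..b} - N \<Longrightarrow> d t > 0"
      "\<And>t l r. \<lbrakk>t \<in> {a..b} - N; a \<le> l; l \<le> t; t \<le> r; r \<le> b; t - l < d t; r - t < d t\<rbrakk> \<Longrightarrow>
         norm (w r - w l) \<le> F r - F l + c * (r - l)"
      using bchoice[of "{a..b} - N" "\<lambda>t d. d>0 \<and> (\<forall>l r. a \<le> l \<longrightarrow> l \<le> t \<longrightarrow> t \<le> r \<longrightarrow> r \<le> b \<longrightarrow> t - l < d \<longrightarrow> r - t < d \<longrightarrow>
        norm (w r - w l) \<le> F r - F l + c * (r - l))"] by blast
    obtain \<delta> where "\<delta> > 0" and \<delta>: "\<forall>(I::(real \<times> real set) set) l r. finite I \<longrightarrow> (\<forall>i\<in>I. a \<le> l i \<and> l i \<le> r i \<and> r i \<le> b) \<longrightarrow>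
       (\<forall>i\<in>I. \<forall>j\<in>I. i \<noteq> j \<longrightarrow> {l i<..<r i} \<inter> {l j<..<r j} = {}) \<longrightarrow>
       (\<Sum>i\<in>I. r i - l i) < \<delta> \<longrightarrow> (\<Sum>i\<in>I. norm (w (r i) - w (l i))) < e/2"
      using abs_continuous_on_finite_family[OF ac e2, where ?'b = "real \<times> real set"] by blast
    have Nl: "N \<in> lmeasurable" "measure lebesgue N = 0"
      using N by (auto simp: negligible_imp_measurable negligible_imp_measure0)
    \<comment> \<open>Outer regularity makes the measure of \<open>U - N\<close> smaller than
      \<delta>, and adding the null set \<open>N\<close> does not change this.\<close>
    obtain U where U: "open U" "N \<subseteq> U" "U \<in> lmeasurable" "measure lebesgue U < \<delta>"
    proof -
      obtain U where U: "open U" "N \<subseteq> U" "U - N \<in> lmeasurable" "emeasure lebesgue (U - N) < ennreal \<delta>"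
        using sets_lebesgue_outer_open[OF fmeasurableD[OF Nl(1)] \<open>\<delta> > 0\<close>] by blast
      have UN: "U = (U - N) \<union> N" using U(2) by blast
      have "U \<in> lmeasurable"
        using fmeasurable.Un[OF U(3) Nl(1)] UN by simp
      moreover have "measure lebesgue U \<le> measure lebesgue (U - N) + measure lebesgue N"
        using measure_Un_le[of "U - N" lebesgue N] UN U(3) Nl(1) by (auto dest: fmeasurableD)
      moreover have "measure lebesgue (U - N) < \<delta>"
        using U(3,4) by (simp add: emeasure_eq_measure2 ennreal_less_iff)
      ultimately show thesis using that U(1,2) Nl(2) by simp
    qed
    \<comment> \<open>Cells tagged in \<open>N\<close> are forced into \<open>U\<close>, all others
      into the neighbourhood where the derivative estimate holds. \<open>UNIV\<close> is a default
      for points outside the interval, which are never tags.\<close>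
    define \<gamma> where "\<gamma> t = (if t \<in> N then U else if t \<in> {a..b} then ball t (d t) else UNIV)" for t
    have "gauge \<gamma>"
      using d(1) U unfolding gauge_def \<gamma>_def by auto
    then obtain p where p: "p tagged_division_of {a..b}" "\<gamma> fine p"
      by (rule fine_division_exists_real)
    \<comment> \<open>Every cell is recovered from its infimum and supremum, which serve as endpoint
      functions from here on.\<close>
    have pD: "Inf K \<in> {a..b} \<and> Sup K \<in> {a..b} \<and> x \<in> {a..b} \<and> Inf K \<le> x \<and> x \<le> Sup K \<and> K = {Inf K..Sup K} \<and> K \<subseteq> \<gamma> x"
      if xK: "(x, K) \<in> p" for x K
    proof -
      obtain l r where K: "K = {l..r}" "x \<in> K" "K \<subseteq> {a..b}"
        using tagged_division_ofD(2-4)[OF p(1) xK] by (metis box_real(2))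
      then have "l \<le> r" by auto
      then have "Inf K = l" "Sup K = r" using K(1) by auto
      then show ?thesis
        using K p(2) xK \<open>l \<le> r\<close> by (auto simp: fine_def)
    qed
    have finp: "finite p" using p(1) by blast
    define q where "q = {(x, K) \<in> p. x \<in> N}"
    have q: "q \<subseteq> p" "finite q" using finp by (auto simp: q_def intro: rev_finite_subset)
    \<comment> \<open>The cells tagged in \<open>N\<close> divide their own union, so their total
      length is the measure of a subset of \<open>U\<close>.\<close>
    have q_td: "q tagged_division_of \<Union>(snd ` q)"
    proof -
      have "q tagged_partial_division_of {a..b}"
        by (rule tagged_partial_division_subset[OF _ q(1)]) (use p(1) in \<open>simp add: tagged_division_of_def\<close>)
      then show ?thesis
        by (rule tagged_partial_division_of_Union_self)
    qed
    have "(\<Sum>(x, K)\<in>q. Sup K - Inf K) = (\<Sum>(x, K)\<in>q. measure lborel K)"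
    proof (rule sum.cong[OF refl], clarify)
      fix x K assume "(x, K) \<in> q"
      then have "K = {Inf K..Sup K}" "Inf K \<le> Sup K"
        using pD[of x K] q(1) by auto
      then show "Sup K - Inf K = measure lborel K"
        by (metis content_real)
    qed
    \<comment> \<open>Cells with different tags can coincide only if their interior is empty; their
      length is then 0, so forgetting the tags does not change the sum.\<close>
    also have "\<dots> = (\<Sum>K\<in>snd ` q. measure lborel K)"
      by (rule sum.over_tagged_division_lemma[OF q_td]) (simp add: content_eq_0_interior)
    also have "\<dots> = measure lebesgue (\<Union>(snd ` q))"
    proof -
      have *: "snd ` q division_of \<Union>(snd ` q)"
        by (rule division_of_tagged_division[OF q_td])
      have "(\<Sum>K\<in>snd ` q. measure lborel K) = (\<Sum>K\<in>snd ` q. measure lebesgue K)"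
      proof (rule sum.cong[OF refl])
        fix K assume "K \<in> snd ` q"
        from division_ofD(4)[OF * this] show "measure lborel K = measure lebesgue K" by auto
      qed
      then show ?thesis
        using content_division[OF *] by simp
    qed
    also have "\<dots> \<le> measure lebesgue U"
    proof (rule measure_mono_fmeasurable[OF _ _ U(3)])
      show "\<Union>(snd ` q) \<subseteq> U"
        using pD by (fastforce simp: q_def \<gamma>_def)
      show "\<Union>(snd ` q) \<in> sets lebesgue"
        using lmeasurable_division[OF division_of_tagged_division[OF q_td]] by blast
    qed
    finally have "(\<Sum>(x, K)\<in>q. Sup K - Inf K) < \<delta>" using U(4) by simp
    then have "(\<Sum>i\<in>q. norm (w (Sup (snd i)) - w (Inf (snd i)))) < e/2"
    proof (intro \<delta>[rule_format] q(2))
      fix i assume "i \<in> q"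
      then show "a \<le> Inf (snd i) \<and> Inf (snd i) \<le> Sup (snd i) \<and> Sup (snd i) \<le> b"
        using pD[of "fst i" "snd i"] q(1) by fastforce
    next
      fix i j assume ij: "i \<in> q" "j \<in> q" "i \<noteq> j"
      have "interior (snd i) \<inter> interior (snd j) = {}"
        using tagged_division_ofD(5)[OF p(1), of "fst i" "snd i" "fst j" "snd j"] ij q(1) by auto
      moreover have "interior (snd k) = {Inf (snd k)<..<Sup (snd k)}" if "k \<in> q" for k
        using pD[of "fst k" "snd k"] that q(1) interior_atLeastAtMost_real
        by (metis prod.collapse subsetD)
      ultimately show "{Inf (snd i)<..<Sup (snd i)} \<inter> {Inf (snd j)<..<Sup (snd j)} = {}"
        using ij by metis
    qed (simp add: case_prod_beta)
    then have bad_sum: "(\<Sum>(x, K)\<in>q. norm (w (Sup K) - w (Inf K))) < e/2"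
      by (simp add: case_prod_beta)
    \<comment> \<open>This lets the sum of the right-hand sides over \<open>p - q\<close> be
      enlarged to a sum over all of \<open>p\<close>, which telescopes.\<close>
    have bad_F: "(\<Sum>(x, K)\<in>q. F (Sup K) - F (Inf K) + c * (Sup K - Inf K)) \<ge> 0"
    proof (rule sum_nonneg, clarify)
      fix x K assume "(x, K) \<in> q"
      then have "a \<le> Inf K" "Inf K \<le> Sup K" "Sup K \<le> b" using pD[of x K] q(1) by auto
      then show "0 \<le> F (Sup K) - F (Inf K) + c * (Sup K - Inf K)"
        using F_mono \<open>c > 0\<close> by simp
    qed
    have good_sum: "(\<Sum>(x, K)\<in>p - q. norm (w (Sup K) - w (Inf K)))
       \<le> (\<Sum>(x, K)\<in>p - q. F (Sup K) - F (Inf K) + c * (Sup K - Inf K))"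
    proof (rule sum_mono, clarify)
      fix x K assume xK: "(x, K) \<in> p" "(x, K) \<notin> q"
      then have x: "x \<in> {a..b} - N" using pD[of x K] by (auto simp: q_def)
      then have "K \<subseteq> ball x (d x)" using pD[OF xK(1)] by (auto simp: \<gamma>_def)
      moreover have "Inf K \<in> K" "Sup K \<in> K" using pD[OF xK(1)]
        by (metis atLeastAtMost_iff order_refl order_trans)+
      ultimately show "norm (w (Sup K) - w (Inf K)) \<le> F (Sup K) - F (Inf K) + c * (Sup K - Inf K)"
        using pD[OF xK(1)] x by (intro d(2)[of x]) (auto simp: subset_iff dist_real_def)
    qed
    have "w b - w a = (\<Sum>(x, K)\<in>p. w (Sup K) - w (Inf K))"
      using additive_tagged_division_1[OF ab p(1), of w] by simp
    then have "norm (w b - w a) \<le> (\<Sum>(x, K)\<in>p. norm (w (Sup K) - w (Inf K)))"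
      by (simp add: case_prod_beta norm_sum)
    also have "\<dots> = (\<Sum>(x, K)\<in>q. norm (w (Sup K) - w (Inf K))) + (\<Sum>(x, K)\<in>p - q. norm (w (Sup K) - w (Inf K)))"
      using sum.subset_diff[OF q(1) finp] by (simp add: add.commute)
    also have "\<dots> \<le> e/2 + (\<Sum>(x, K)\<in>p. F (Sup K) - F (Inf K) + c * (Sup K - Inf K))"
      using bad_sum bad_F good_sum
        sum.subset_diff[OF q(1) finp, of "\<lambda>(x, K). F (Sup K) - F (Inf K) + c * (Sup K - Inf K)"] by linarith
    also have "(\<Sum>(x, K)\<in>p. F (Sup K) - F (Inf K) + c * (Sup K - Inf K)) = F b - F a + c * (b - a)"
      using additive_tagged_division_1[OF ab p(1), of "\<lambda>x. F x + c * x"]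
      by (simp add: algebra_simps)
    finally show ?thesis using c_le by simp
  qed
  then show ?thesis
    by (rule field_le_epsilon)
qed

text \<open>The mean value estimate turns the differential inequality into
  \<open>norm (w s) \<le> norm (w 0) + F s\<close>, where \<open>F\<close> is the integral of
  \<open>L * norm (w s) + c\<close>. From there on only the differentiable scalar function
  \<open>F\<close> has to be estimated.\<close>

lemma gronwall_abs_continuous:
  fixes w :: "real \<Rightarrow> 'a::real_normed_vector"
  assumes ac: "abs_continuous_on 0 T w" and N: "negligible N" and L: "L > 0" and c: "c \<ge> 0"
    and w: "\<And>t. t \<in> {0..T} - N \<Longrightarrow>
              \<exists>w'. (w has_vector_derivative w') (at t within {0..T}) \<and> norm w' \<le> L * norm (w t) + c"
    and t: "t \<in> {0..T}"
  shows "norm (w t) \<le> (norm (w 0) + c / L) * exp (L * t)"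
proof -
  define h where "h s = L * norm (w s) + c" for s
  define F where "F s = integral {0..s} h" for s
  have "continuous_on {0..T} h"
    unfolding h_def using abs_continuous_on_imp_continuous_on[OF ac] by (intro continuous_intros)
  then have F: "(F has_vector_derivative h s) (at s within {0..T})" if "s \<in> {0..T}" for s
    unfolding F_def using that by (rule integral_has_vector_derivative)
  have h_nonneg: "h s \<ge> 0" for s
    using L c by (simp add: h_def)
  have w_le: "norm (w s) \<le> norm (w 0) + F s" if s: "s \<in> {0..T}" for s
  proof -
    have sub: "{0..s} \<subseteq> {0..T}" using s by auto
    have "norm (w s - w 0) \<le> F s - F 0"
    proof (rule abs_continuous_on_norm_diff_le[OF _ _ N])
      show "abs_continuous_on 0 s w"
        using ac s by (auto intro: abs_continuous_on_subinterval)
      show "(F has_vector_derivative h r) (at r within {0..s})" if "r \<in> {0..s}" for r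
        using that sub F has_vector_derivative_within_subset by blast
      show "\<exists>w'. (w has_vector_derivative w') (at r within {0..s}) \<and> norm w' \<le> h r"
        if "r \<in> {0..s} - N" for r
      proof -
        have "r \<in> {0..T} - N" using that sub by blast
        from w[OF this] show ?thesis
          unfolding h_def using sub has_vector_derivative_within_subset by blast
      qed
    qed (use s h_nonneg in auto)
    moreover have "F 0 = 0" by (simp add: F_def)
    ultimately show ?thesis
      using norm_triangle_sub[of "w s" "w 0"] by simp
  qed
  \<comment> \<open>Integrating factor: the integral inequality says
    \<open>F' \<le> L * (F + norm (w 0) + c / L)\<close>, so multiplying the bracket by the decaying
    exponential gives a function with nonpositive derivative. The shift \<open>c / L\<close> absorbs
    the inhomogeneity \<open>c\<close>.\<close>
  define v where "v s = (F s + norm (w 0) + c / L) * exp (- L * s)" for s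
  have v: "(v has_vector_derivative (h s - L * (F s + norm (w 0) + c / L)) * exp (- L * s)) (at s within {0..T})"
    if "s \<in> {0..T}" for s
  proof -
    have "(F has_real_derivative h s) (at s within {0..T})"
      using F[OF that] by (simp add: has_real_derivative_iff_has_vector_derivative)
    then have "(v has_real_derivative (h s - L * (F s + norm (w 0) + c / L)) * exp (- L * s)) (at s within {0..T})"
      unfolding v_def by (auto intro!: derivative_eq_intros simp: algebra_simps)
    then show ?thesis
      by (simp add: has_real_derivative_iff_has_vector_derivative)
  qed
  have "v t \<le> v 0"
  proof -
    have sub: "{0..t} \<subseteq> {0..T}" using t by auto
    have "\<exists>x\<in>{0..t}. v t - v 0 = (\<lambda>k. k *\<^sub>R ((h x - L * (F x + norm (w 0) + c / L)) * exp (- L * x))) (t - 0)"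
    proof (rule mvt_very_simple)
      fix x assume "0 \<le> x" "x \<le> t"
      then show "(v has_derivative (\<lambda>k. k *\<^sub>R ((h x - L * (F x + norm (w 0) + c / L)) * exp (- L * x)))) (at x within {0..t})"
        using v[of x] t sub has_derivative_subset[OF _ sub] unfolding has_vector_derivative_def by auto
    qed (use t in auto)
    then obtain x where x: "x \<in> {0..t}"
      and eq: "v t - v 0 = t * ((h x - L * (F x + norm (w 0) + c / L)) * exp (- L * x))" by auto
    have "h x \<le> L * (F x + norm (w 0) + c / L)"
      using mult_left_mono[OF w_le[of x], of L] x sub L by (auto simp: h_def algebra_simps)
    then have "(h x - L * (F x + norm (w 0) + c / L)) * exp (- L * x) \<le> 0"
      by (intro mult_nonpos_nonneg) (simp_all only: diff_le_0_iff_le exp_ge_zero)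
    note neg = this
    have "t * ((h x - L * (F x + norm (w 0) + c / L)) * exp (- L * x)) \<le> 0"
      by (rule mult_nonneg_nonpos[OF _ neg]) (use t in simp)
    then show ?thesis using eq by linarith
  qed
  have v0: "v 0 = norm (w 0) + c / L" by (simp add: v_def F_def)
  have "v t * exp (L * t) \<le> (norm (w 0) + c / L) * exp (L * t)"
    using \<open>v t \<le> v 0\<close> unfolding v0 by simp
  moreover have "v t * exp (L * t) = F t + norm (w 0) + c / L"
    by (simp add: v_def mult.assoc flip: exp_add)
  \<comment> \<open>The shift is dropped from the left-hand side, at the price of a slightly weaker
    bound.\<close>
  moreover have "c / L \<ge> 0" using c L by simp
  ultimately show ?thesis using w_le[OF t] by linarith
qed

section \<open>Uniform approximation by ReLU networks\<close>

text \<open>Linear combinations of exponentials of linear forms. They are closed under products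
  because exponents add, which ReLU networks are not, and each summand depends only on the single
  real quantity \<open>a \<bullet> x\<close>. Hence they mediate between Stone-Weierstrass and
  piecewise linear interpolation.\<close>

inductive_set exp_sums :: "('a::real_inner \<Rightarrow> real) set" where
  zero: "(\<lambda>_. 0) \<in> exp_sums"
| add_term: "g \<in> exp_sums \<Longrightarrow> (\<lambda>x. g x + c * exp (a \<bullet> x)) \<in> exp_sums"

lemma exp_sums_add:
  assumes "f \<in> exp_sums" "g \<in> exp_sums"
  shows "(\<lambda>x. f x + g x) \<in> exp_sums"
  using assms(2)
proof induction
  case (add_term g c a)
  from exp_sums.add_term[OF add_term.IH, of c a] show ?case by (simp add: add.assoc)
qed (simp add: assms(1))

lemma exp_sums_mult_term:
  assumes "f \<in> exp_sums"
  shows "(\<lambda>x. f x * (c * exp (a \<bullet> x))) \<in> exp_sums"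
  using assms
proof induction
  case (add_term g c' a')
  from exp_sums.add_term[OF add_term.IH, of "c' * c" "a' + a"] show ?case
    by (simp add: algebra_simps exp_add)
qed (simp add: exp_sums.zero)

lemma exp_sums_mult:
  assumes "f \<in> exp_sums" "g \<in> exp_sums"
  shows "(\<lambda>x. f x * g x) \<in> exp_sums"
  using assms(2)
proof induction
  case (add_term g c a)
  from exp_sums_add[OF add_term.IH exp_sums_mult_term[OF assms(1)], of c a] show ?case
    by (simp add: algebra_simps)
qed (simp add: exp_sums.zero)

lemma continuous_on_exp_sums:
  assumes "g \<in> exp_sums"
  shows "continuous_on S g"
  using assms by induction (auto intro!: continuous_intros)

lemma function_ring_on_exp_sums:
  fixes S :: "'a::real_inner set"
  assumes "compact S"
  shows "function_ring_on exp_sums S"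
proof
  show "(\<lambda>_. c) \<in> exp_sums" for c
    using exp_sums.add_term[OF exp_sums.zero, of c 0] by simp
  \<comment> \<open>The linear form with coefficient \<open>x - y\<close> separates the two points,
    and the exponential is injective.\<close>
  show "\<exists>f\<in>exp_sums. f x \<noteq> f y" if "x \<noteq> y" for x y :: 'a
  proof
    show "(\<lambda>z. exp ((x - y) \<bullet> z)) \<in> exp_sums"
      using exp_sums.add_term[OF exp_sums.zero, of 1 "x - y"] by simp
    have "(x - y) \<bullet> (x - y) \<noteq> 0" using that by simp
    then show "exp ((x - y) \<bullet> x) \<noteq> exp ((x - y) \<bullet> y)"
      by (simp add: inner_diff_right)
  qed
qed (simp_all add: assms exp_sums_add exp_sums_mult continuous_on_exp_sums)

text \<open>Networks with one hidden layer, scalar units and vector-valued outer weights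
  \<open>c\<close>. The input space is abstract, so that it can later be the product of state space
  and time.\<close>

inductive_set relu_nets :: "('a::real_inner \<Rightarrow> 'e::real_normed_vector) set" where
  zero: "(\<lambda>_. 0) \<in> relu_nets"
| add_unit: "g \<in> relu_nets \<Longrightarrow> (\<lambda>x. g x + relu (a \<bullet> x + b) *\<^sub>R c) \<in> relu_nets"

lemma relu_nets_add:
  assumes "f \<in> relu_nets" "g \<in> relu_nets"
  shows "(\<lambda>x. f x + g x) \<in> relu_nets"
  using assms(2)
proof induction
  case (add_unit g a b c)
  from relu_nets.add_unit[OF add_unit.IH, of a b c] show ?case by (simp add: add.assoc)
qed (simp add: assms(1))

lemma relu_nets_unit: "(\<lambda>x. relu (a \<bullet> x + b) *\<^sub>R c) \<in> relu_nets"
  using relu_nets.add_unit[OF relu_nets.zero, of a b c] by simp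

text \<open>A unit with zero input weight and bias 1 is constantly 1, which simulates an output
  bias.\<close>

lemma relu_nets_const: "(\<lambda>_. c) \<in> relu_nets"
  using relu_nets_unit[of 0 1 c] by (simp add: relu_def)

lemma relu_nets_scaleR_const:
  assumes "g \<in> relu_nets"
  shows "(\<lambda>x. g x *\<^sub>R v) \<in> relu_nets"
  using assms
proof induction
  case (add_unit g a b c)
  from relu_nets.add_unit[OF add_unit.IH, of a b "c *\<^sub>R v"] show ?case
    by (simp add: scaleR_add_left)
qed (simp add: relu_nets.zero)

lemma relu_nets_compose_inner:
  fixes g :: "real \<Rightarrow> 'e::real_normed_vector"
  assumes "g \<in> relu_nets"
  shows "(\<lambda>x. g (a \<bullet> x)) \<in> relu_nets"
  using assms
proof induction
  case (add_unit g a' b c)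
  from relu_nets.add_unit[OF add_unit.IH, of "a' *\<^sub>R a" b c] show ?case by simp
qed (simp add: relu_nets.zero)

text \<open>The padding, i.e. the freedom in n, allows nets of different sizes to be run in parallel.\<close>

lemma relu_nets_indexed:
  assumes "g \<in> relu_nets"
  shows "\<exists>(N::nat) a b c. \<forall>n\<ge>N. \<forall>x. g x = (\<Sum>i<n. relu (a i \<bullet> x + b i) *\<^sub>R c i)"
  using assms
proof induction
  case zero
  have "\<forall>n\<ge>0. \<forall>x::'a. (0::'b) = (\<Sum>i<n. relu ((\<lambda>_. 0) i \<bullet> x + (\<lambda>_. 0) i) *\<^sub>R (\<lambda>_. 0) i)"
    by simp
  then show ?case by (intro exI)
next
  case (add_unit g a' b' c')
  obtain N :: nat and a b c where *: "\<forall>n\<ge>N. \<forall>x. g x = (\<Sum>i<n. relu (a i \<bullet> x + b i) *\<^sub>R c i)"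
    using add_unit.IH by (elim exE)
  \<comment> \<open>The new unit takes index 0 and \<open>case_nat\<close> shifts the others by one.
    The families of the empty net are identically zero, so all units beyond the used indices
    contribute nothing.\<close>
  have "\<forall>n\<ge>Suc N. \<forall>x. g x + relu (a' \<bullet> x + b') *\<^sub>R c' =
      (\<Sum>i<n. relu (case_nat a' a i \<bullet> x + case_nat b' b i) *\<^sub>R case_nat c' c i)"
  proof (intro allI impI)
    fix n x assume "n \<ge> Suc N"
    then obtain m where m: "n = Suc m" "m \<ge> N" by (cases n) auto
    show "g x + relu (a' \<bullet> x + b') *\<^sub>R c' =
      (\<Sum>i<n. relu (case_nat a' a i \<bullet> x + case_nat b' b i) *\<^sub>R case_nat c' c i)"
      using *[rule_format, OF m(2), of x]
      by (simp add: m(1) sum.lessThan_Suc_shift add.commute del: sum.lessThan_Suc)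
  qed
  then show ?case by (intro exI)
qed

definition relu_approximable :: "'a::real_inner set \<Rightarrow> ('a \<Rightarrow> 'e::real_normed_vector) \<Rightarrow> bool" where
  "relu_approximable S f \<longleftrightarrow> (\<forall>e>0. \<exists>g\<in>relu_nets. \<forall>x\<in>S. norm (f x - g x) \<le> e)"

lemma relu_approximable_add:
  assumes "relu_approximable S f" "relu_approximable S g"
  shows "relu_approximable S (\<lambda>x. f x + g x)"
  unfolding relu_approximable_def
proof (intro allI impI)
  fix e :: real assume "e > 0"
  then have "e/2 > 0" by simp
  then obtain f' g' where f': "f' \<in> relu_nets" "\<forall>x\<in>S. norm (f x - f' x) \<le> e/2"
    and g': "g' \<in> relu_nets" "\<forall>x\<in>S. norm (g x - g' x) \<le> e/2"
    using assms unfolding relu_approximable_def by blast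
  have "norm (f x + g x - (f' x + g' x)) \<le> e" if "x \<in> S" for x
    using f'(2) g'(2) that norm_triangle_ineq[of "f x - f' x" "g x - g' x"]
    by (fastforce simp: algebra_simps)
  then show "\<exists>h\<in>relu_nets. \<forall>x\<in>S. norm (f x + g x - h x) \<le> e"
    by (intro bexI[OF _ relu_nets_add[OF f'(1) g'(1)]] ballI)
qed

lemma relu_approximable_zero: "relu_approximable S (\<lambda>_. 0)"
  unfolding relu_approximable_def using relu_nets.zero by force

lemma relu_approximable_sum:
  assumes "\<And>i. i \<in> I \<Longrightarrow> relu_approximable S (f i)"
  shows "relu_approximable S (\<lambda>x. \<Sum>i\<in>I. f i x)"
  using assms
  by (induction I rule: infinite_finite_induct) (auto simp: relu_approximable_zero relu_approximable_add)

lemma relu_approximable_scaleR_const: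
  assumes "relu_approximable S f"
  shows "relu_approximable S (\<lambda>x. f x *\<^sub>R v)"
  unfolding relu_approximable_def
proof (intro allI impI)
  fix e :: real assume "e > 0"
  \<comment> \<open>Dividing by \<open>norm v + 1\<close> instead of \<open>norm v\<close> covers
    \<open>v = 0\<close>.\<close>
  have pos: "norm v + 1 > 0" by (simp add: add_nonneg_pos)
  then have "e / (norm v + 1) > 0" using \<open>e > 0\<close> by simp
  then obtain g where g: "g \<in> relu_nets" "\<forall>x\<in>S. norm (f x - g x) \<le> e / (norm v + 1)"
    using assms unfolding relu_approximable_def by blast
  have "norm (f x *\<^sub>R v - g x *\<^sub>R v) \<le> e" if "x \<in> S" for x
  proof -
    have "norm (f x *\<^sub>R v - g x *\<^sub>R v) = norm (f x - g x) * norm v"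
      by (simp flip: scaleR_left_diff_distrib)
    also have "\<dots> \<le> e / (norm v + 1) * (norm v + 1)"
      using g(2) that pos by (intro mult_mono) auto
    also have "\<dots> = e" using pos by simp
    finally show ?thesis .
  qed
  then show "\<exists>h\<in>relu_nets. \<forall>x\<in>S. norm (f x *\<^sub>R v - h x) \<le> e"
    by (intro bexI[OF _ relu_nets_scaleR_const[OF g(1), of v]] ballI)
qed

text \<open>The net interpolates \<phi> linearly between the nodes and stays constant after the last
  one. The constant tail is the part of the induction hypothesis to which the next linear piece is
  attached; it also supplies the value at the right end, which the half-open interval omits.\<close>

lemma relu_piecewise_linear_interpolation:
  fixes \<phi> :: "real \<Rightarrow> real"
  assumes h: "h > 0"
    and osc: "\<And>i s. i < n \<Longrightarrow> \<alpha> + real i * h \<le> s \<Longrightarrow> s \<le> \<alpha> + real (Suc i) * h \<Longrightarrow>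
      \<bar>\<phi> (\<alpha> + real i * h) - \<phi> s\<bar> \<le> e \<and> \<bar>\<phi> (\<alpha> + real (Suc i) * h) - \<phi> s\<bar> \<le> e"
  shows "\<exists>g\<in>relu_nets. (\<forall>s\<in>{\<alpha>..<\<alpha> + real n * h}. \<bar>\<phi> s - g s\<bar> \<le> e) \<and> (\<forall>s\<ge>\<alpha> + real n * h. g s = \<phi> (\<alpha> + real n * h))"
  using osc
proof (induction n)
  case 0
  show ?case by (rule bexI[OF _ relu_nets_const]) auto
next
  case (Suc n)
  then obtain g where g: "g \<in> relu_nets" "\<forall>s\<in>{\<alpha>..<\<alpha> + real n * h}. \<bar>\<phi> s - g s\<bar> \<le> e"
    "\<forall>s\<ge>\<alpha> + real n * h. g s = \<phi> (\<alpha> + real n * h)"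
    using less_SucI by blast
  define p q where "p = \<alpha> + real n * h" and "q = \<alpha> + real (Suc n) * h"
  have pq: "q = p + h" by (simp add: p_def q_def algebra_simps)
  \<comment> \<open>The slope needed on the new cell. One unit switches it on at \<open>p\<close>, a
    second one switches it off at \<open>q\<close>.\<close>
  define c where "c = (\<phi> q - \<phi> p) / h"
  define g' where "g' s = g s + relu (1 \<bullet> s + - p) *\<^sub>R c + relu (1 \<bullet> s + - q) *\<^sub>R (- c)" for s
  have g'_eq: "g' s = g s + (relu (s - p) - relu (s - q)) * c" for s
    by (simp add: g'_def algebra_simps)
  have "g' \<in> relu_nets"
    unfolding g'_def by (intro relu_nets.add_unit g(1))
  moreover have "\<bar>\<phi> s - g' s\<bar> \<le> e" if s: "\<alpha> \<le> s" "s < q" for s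
  proof (cases "s < p")
    case True
    then show ?thesis using g(2) s h by (simp add: g'_eq relu_def pq p_def)
  next
    case False
    \<comment> \<open>On the new cell the net is a convex combination of the two node values, and
      each of them is within \<open>e\<close> of \<open>\<phi> s\<close>.\<close>
    define \<theta> where "\<theta> = (s - p) / h"
    have \<theta>: "0 \<le> \<theta>" "\<theta> \<le> 1" using False s h by (auto simp: \<theta>_def pq field_simps)
    have "g' s = \<phi> p + \<theta> * (\<phi> q - \<phi> p)"
      using False s g(3) by (simp add: g'_eq relu_def p_def[symmetric] \<theta>_def c_def)
    then have "\<phi> s - g' s = (1 - \<theta>) * (\<phi> s - \<phi> p) + \<theta> * (\<phi> s - \<phi> q)"
      by (simp add: algebra_simps)
    also have "\<bar>\<dots>\<bar> \<le> (1 - \<theta>) * \<bar>\<phi> s - \<phi> p\<bar> + \<theta> * \<bar>\<phi> s - \<phi> q\<bar>"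
      using \<theta> abs_triangle_ineq[of "(1 - \<theta>) * (\<phi> s - \<phi> p)" "\<theta> * (\<phi> s - \<phi> q)"] by (simp add: abs_mult)
    also have "\<dots> \<le> (1 - \<theta>) * e + \<theta> * e"
      using Suc.prems[of n s] False s \<theta>
      by (intro add_mono mult_left_mono) (auto simp: p_def q_def abs_minus_commute)
    also have "\<dots> = e" by (simp add: algebra_simps)
    finally show ?thesis .
  qed
  moreover have "g' s = \<phi> q" if "s \<ge> q" for s
    using that g(3) h by (simp add: g'_eq relu_def p_def[symmetric] pq c_def)
  ultimately show ?case
    unfolding q_def[symmetric] by (intro bexI[of _ g'] conjI ballI allI impI) simp_all
qed

lemma relu_approximable_interval:
  fixes \<phi> :: "real \<Rightarrow> real"
  assumes "continuous_on {\<alpha>..\<beta>} \<phi>" "\<alpha> < \<beta>"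
  shows "relu_approximable {\<alpha>..\<beta>} \<phi>"
  unfolding relu_approximable_def
proof (intro allI impI)
  fix e :: real assume e: "e > 0"
  have "uniformly_continuous_on {\<alpha>..\<beta>} \<phi>"
    using assms(1) by (intro compact_uniformly_continuous) auto
  then obtain d where d: "d > 0" "\<And>s t. s \<in> {\<alpha>..\<beta>} \<Longrightarrow> t \<in> {\<alpha>..\<beta>} \<Longrightarrow> dist s t < d \<Longrightarrow> dist (\<phi> s) (\<phi> t) < e"
    using e unfolding uniformly_continuous_on_def by blast
  \<comment> \<open>Enough cells for the mesh \<open>h\<close> to fall below the modulus of
    continuity \<open>d\<close>.\<close>
  obtain n :: nat where n: "(\<beta> - \<alpha>) / d < real n"
    using reals_Archimedean2 by blast
  moreover have "(\<beta> - \<alpha>) / d > 0" using assms(2) d(1) by simp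
  ultimately have npos: "real n > 0" by linarith
  define h where "h = (\<beta> - \<alpha>) / real n"
  have h: "h > 0" "h < d" "\<alpha> + real n * h = \<beta>"
    using assms(2) npos n d(1) by (auto simp: h_def field_simps)
  have "\<exists>g\<in>relu_nets. (\<forall>s\<in>{\<alpha>..<\<alpha> + real n * h}. \<bar>\<phi> s - g s\<bar> \<le> e) \<and> (\<forall>s\<ge>\<alpha> + real n * h. g s = \<phi> (\<alpha> + real n * h))"
  proof (rule relu_piecewise_linear_interpolation[OF h(1)])
    fix i s assume i: "i < n" and s: "\<alpha> + real i * h \<le> s" "s \<le> \<alpha> + real (Suc i) * h"
    have "real (Suc i) * h \<le> real n * h" using i h(1) by (intro mult_right_mono) auto
    moreover have "real i * h \<ge> 0" using h(1) by simp
    moreover have "real (Suc i) * h = real i * h + h" by (simp add: algebra_simps)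
    ultimately have "0 \<le> real i * h \<and> real i * h + h = real (Suc i) * h \<and> real i * h + h \<le> real n * h" by linarith
    then have "\<alpha> + real i * h \<in> {\<alpha>..\<beta>}" "\<alpha> + real (Suc i) * h \<in> {\<alpha>..\<beta>}" "s \<in> {\<alpha>..\<beta>}"
      "dist (\<alpha> + real i * h) s < d" "dist (\<alpha> + real (Suc i) * h) s < d"
      unfolding dist_real_def atLeastAtMost_iff using s h by linarith+
    then show "\<bar>\<phi> (\<alpha> + real i * h) - \<phi> s\<bar> \<le> e \<and> \<bar>\<phi> (\<alpha> + real (Suc i) * h) - \<phi> s\<bar> \<le> e"
      using d(2)[of "\<alpha> + real i * h" s] d(2)[of "\<alpha> + real (Suc i) * h" s]
      by (simp add: dist_real_def del: of_nat_Suc)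
  qed
  then obtain g where g: "g \<in> relu_nets" "\<forall>s\<in>{\<alpha>..<\<beta>}. \<bar>\<phi> s - g s\<bar> \<le> e" "g \<beta> = \<phi> \<beta>"
    unfolding h(3) by blast
  have "norm (\<phi> x - g x) \<le> e" if "x \<in> {\<alpha>..\<beta>}" for x
    using g(2,3) that e by (cases "x = \<beta>") auto
  then show "\<exists>g\<in>relu_nets. \<forall>x\<in>{\<alpha>..\<beta>}. norm (\<phi> x - g x) \<le> e"
    using g(1) by blast
qed

lemma relu_approximable_ridge:
  fixes \<phi> :: "real \<Rightarrow> real"
  assumes "continuous_on UNIV \<phi>" "bounded S"
  shows "relu_approximable S (\<lambda>x. \<phi> (a \<bullet> x))"
  unfolding relu_approximable_def
proof (intro allI impI)
  fix e :: real assume "e > 0"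
  obtain B where B: "B > 0" "\<And>x. x \<in> S \<Longrightarrow> norm x \<le> B"
    using assms(2) by (auto simp: bounded_pos)
  \<comment> \<open>By Cauchy-Schwarz \<open>a \<bullet> x\<close> has absolute value at most
    \<open>norm a * B\<close>; adding 1 keeps the interval nondegenerate even for
    \<open>a = 0\<close>.\<close>
  define r where "r = norm a * B + 1"
  have "r > 0" using B(1) by (simp add: r_def add_nonneg_pos)
  have r: "a \<bullet> x \<in> {-r..r}" if "x \<in> S" for x
    using Cauchy_Schwarz_ineq2[of a x] mult_left_mono[OF B(2)[OF that], of "norm a"]
    by (auto simp: r_def abs_le_iff)
  have "relu_approximable {-r..r} \<phi>"
    using assms(1) \<open>r > 0\<close> by (intro relu_approximable_interval) (auto intro: continuous_on_subset)
  then obtain g where g: "g \<in> relu_nets" "\<forall>s\<in>{-r..r}. norm (\<phi> s - g s) \<le> e"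
    using \<open>e > 0\<close> unfolding relu_approximable_def by blast
  show "\<exists>g\<in>relu_nets. \<forall>x\<in>S. norm (\<phi> (a \<bullet> x) - g x) \<le> e"
    by (rule bexI[OF _ relu_nets_compose_inner[OF g(1), of a]]) (use g(2) r in blast)
qed

lemma relu_approximable_exp_sums:
  assumes "g \<in> exp_sums" "bounded S"
  shows "relu_approximable S g"
  using assms(1)
proof induction
  case (add_term g c a)
  have "continuous_on UNIV (\<lambda>s::real. c * exp s)" by (intro continuous_intros)
  from relu_approximable_add[OF add_term.IH relu_approximable_ridge[OF this assms(2)]]
  show ?case .
qed (rule relu_approximable_zero)

theorem relu_universal_approximation:
  fixes f :: "'a::real_inner \<Rightarrow> 'e::euclidean_space"
  assumes "compact S" "continuous_on S f"
  shows "relu_approximable S f"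
proof -
  have scalar: "relu_approximable S g" if cont: "continuous_on S g" for g :: "'a \<Rightarrow> real"
    unfolding relu_approximable_def
  proof (intro allI impI)
    fix e :: real assume "e > 0"
    then have e2: "e/2 > 0" by simp
    interpret function_ring_on exp_sums S by (rule function_ring_on_exp_sums[OF assms(1)])
    obtain h where h: "h \<in> exp_sums" "\<forall>x\<in>S. \<bar>g x - h x\<bar> < e/2"
      using Stone_Weierstrass_basic[OF cont e2] by (elim bexE)
    obtain k where k: "k \<in> relu_nets" "\<forall>x\<in>S. norm (h x - k x) \<le> e/2"
      using relu_approximable_exp_sums[OF h(1) compact_imp_bounded[OF assms(1)]] e2
      unfolding relu_approximable_def by (elim allE[of _ "e/2"] impE bexE)
    have "norm (g x - k x) \<le> e" if "x \<in> S" for x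
      using bspec[OF h(2) that] bspec[OF k(2) that] unfolding real_norm_def by linarith
    then show "\<exists>k\<in>relu_nets. \<forall>x\<in>S. norm (g x - k x) \<le> e"
      by (intro bexI[OF _ k(1)] ballI)
  qed
  \<comment> \<open>The vector-valued case is assembled from the scalar coordinates in an
    orthonormal basis.\<close>
  have "relu_approximable S (\<lambda>x. \<Sum>b\<in>Basis. (f x \<bullet> b) *\<^sub>R b)"
    using assms(2) by (intro relu_approximable_sum relu_approximable_scaleR_const scalar continuous_intros)
  then show ?thesis by (simp add: euclidean_representation)
qed

text \<open>Joint continuity follows by passing through the point \<open>(x, s)\<close>: the
  Lipschitz constant is uniform in time, and only the continuity at the fixed \<open>x\<close> is
  used for the change of time. Universal approximation in space and time requires this joint
  form.\<close>

lemma continuous_on_Times_lipschitz: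
  fixes g :: "'a::real_normed_vector \<Rightarrow> 'b::metric_space \<Rightarrow> 'e::real_normed_vector"
  assumes cont: "\<And>x. continuous_on I (g x)" and L: "L > 0"
    and lip: "\<And>x y t. t \<in> I \<Longrightarrow> norm (g x t - g y t) \<le> L * norm (x - y)"
  shows "continuous_on (UNIV \<times> I) (\<lambda>(x, t). g x t)"
  unfolding continuous_on_iff
proof (intro ballI allI impI)
  fix p :: "'a \<times> 'b" and e :: real
  assume p: "p \<in> UNIV \<times> I" and e: "e > 0"
  obtain x t where xt: "p = (x, t)" "t \<in> I" using p by auto
  have e2: "e/2 > 0" using e by simp
  obtain d where d: "d > 0" "\<And>s. s \<in> I \<Longrightarrow> dist s t < d \<Longrightarrow> dist (g x s) (g x t) < e/2"
    using cont[of x, unfolded continuous_on_iff, THEN bspec, OF xt(2), THEN spec, THEN mp, OF e2] by blast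
  show "\<exists>d>0. \<forall>q\<in>UNIV \<times> I. dist q p < d \<longrightarrow> dist (case q of (x, t) \<Rightarrow> g x t) (case p of (x, t) \<Rightarrow> g x t) < e"
  proof (intro exI[of _ "min d (e / (2 * L))"] conjI ballI impI)
    fix q assume q: "q \<in> UNIV \<times> I" "dist q p < min d (e / (2 * L))"
    obtain y s where ys: "q = (y, s)" "s \<in> I" using q by auto
    have yx: "dist y x < e / (2 * L)" and st: "dist s t < d"
      using q(2) dist_fst_le[of q p] dist_snd_le[of q p] by (auto simp: xt ys)
    have "dist (g y s) (g x s) \<le> L * dist y x"
      using lip[OF ys(2)] by (simp add: dist_norm)
    also have "\<dots> < L * (e / (2 * L))"
      using yx L by (rule mult_strict_left_mono)
    also have "\<dots> = e/2" using L by simp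
    finally have "dist (g y s) (g x t) < e"
      using d(2)[OF ys(2) st] dist_triangle[of "g y s" "g x t" "g x s"] by linarith
    then show "dist (case q of (x, t) \<Rightarrow> g x t) (case p of (x, t) \<Rightarrow> g x t) < e"
      by (simp add: xt ys)
  qed (use d(1) e L in auto)
qed

text \<open>Row \<open>k\<close> of a Hadamard unit involves only row \<open>k\<close> of each
  parameter, so the rows of the output are independent one-layer nets. They are run in parallel
  after padding to a common width; the weight of each unit splits into \<open>fst\<close>, acting on
  the state, and \<open>snd\<close>, acting on time.\<close>

lemma ex_sa_control_components:
  fixes g :: "'d::finite \<Rightarrow> (real ^ 'd) \<times> real \<Rightarrow> real ^ 'm"
  assumes "\<And>k. g k \<in> relu_nets"
  shows "\<exists>Q\<ge>1. \<exists>W A1 A2 B. \<forall>y t k. sa_control Q W A1 A2 B y t $ k = g k (y, t)"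
proof -
  have "\<forall>k. \<exists>(N::nat) a b c. \<forall>n\<ge>N. \<forall>x. g k x = (\<Sum>i<n. relu (a i \<bullet> x + b i) *\<^sub>R c i)"
    by (intro allI relu_nets_indexed assms)
  then obtain N :: "'d \<Rightarrow> nat" where "\<forall>k. \<exists>a b c. \<forall>n\<ge>N k. \<forall>x. g k x = (\<Sum>i<n. relu (a i \<bullet> x + b i) *\<^sub>R c i)"
    by (rule exE[OF choice])
  then obtain a where "\<forall>k. \<exists>b c. \<forall>n\<ge>N k. \<forall>x. g k x = (\<Sum>i<n. relu (a k i \<bullet> x + b i) *\<^sub>R c i)"
    by (rule exE[OF choice])
  then obtain b where "\<forall>k. \<exists>c. \<forall>n\<ge>N k. \<forall>x. g k x = (\<Sum>i<n. relu (a k i \<bullet> x + b k i) *\<^sub>R c i)"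
    by (rule exE[OF choice])
  then obtain c where net: "\<forall>k. \<forall>n\<ge>N k. \<forall>x. g k x = (\<Sum>i<n. relu (a k i \<bullet> x + b k i) *\<^sub>R c k i)"
    by (rule exE[OF choice])
  \<comment> \<open>The sum dominates every \<open>N k\<close>, and the successor guarantees width
    at least 1.\<close>
  define Q where "Q = Suc (\<Sum>k\<in>UNIV. N k)"
  have Q: "N k \<le> Q" for k
    using member_le_sum[of k UNIV N] by (simp add: Q_def)
  have "sa_control Q (\<lambda>i. \<chi> k. c k i) (\<lambda>i. \<chi> k. fst (a k i)) (\<lambda>i. \<chi> k. snd (a k i)) (\<lambda>i. \<chi> k. b k i) y t $ k
      = g k (y, t)" for y t k
    unfolding net[rule_format, OF Q] sa_control_def
    by (simp add: vec_eq_iff row_hadamard_def relu_vec_def matrix_vector_mul_component inner_prod_def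
        mult.commute)
  then show ?thesis
    unfolding Q_def by (intro exI[of _ "Suc (sum N UNIV)"] conjI exI) auto
qed

text \<open>The same parallel arrangement, with a scalar outer weight in each row.\<close>

lemma ex_sa_drift_components:
  fixes g :: "'d::finite \<Rightarrow> (real ^ 'd) \<times> real \<Rightarrow> real"
  assumes "\<And>k. g k \<in> relu_nets"
  shows "\<exists>P\<ge>1. \<exists>W A1 A2 B. \<forall>y t k. sa_drift P W A1 A2 B y t $ k = g k (y, t)"
proof -
  have "\<forall>k. \<exists>(N::nat) a b c. \<forall>n\<ge>N. \<forall>x. g k x = (\<Sum>i<n. relu (a i \<bullet> x + b i) *\<^sub>R c i)"
    by (intro allI relu_nets_indexed assms)
  then obtain N :: "'d \<Rightarrow> nat" where "\<forall>k. \<exists>a b c. \<forall>n\<ge>N k. \<forall>x. g k x = (\<Sum>i<n. relu (a i \<bullet> x + b i) *\<^sub>R c i)"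
    by (rule exE[OF choice])
  then obtain a where "\<forall>k. \<exists>b c. \<forall>n\<ge>N k. \<forall>x. g k x = (\<Sum>i<n. relu (a k i \<bullet> x + b i) *\<^sub>R c i)"
    by (rule exE[OF choice])
  then obtain b where "\<forall>k. \<exists>c. \<forall>n\<ge>N k. \<forall>x. g k x = (\<Sum>i<n. relu (a k i \<bullet> x + b k i) *\<^sub>R c i)"
    by (rule exE[OF choice])
  then obtain c where net: "\<forall>k. \<forall>n\<ge>N k. \<forall>x. g k x = (\<Sum>i<n. relu (a k i \<bullet> x + b k i) *\<^sub>R c k i)"
    by (rule exE[OF choice])
  define P where "P = Suc (\<Sum>k\<in>UNIV. N k)"
  have P: "N k \<le> P" for k
    using member_le_sum[of k UNIV N] by (simp add: P_def)
  have "sa_drift P (\<lambda>i. \<chi> k. c k i) (\<lambda>i. \<chi> k. fst (a k i)) (\<lambda>i. \<chi> k. snd (a k i)) (\<lambda>i. \<chi> k. b k i) y t $ k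
      = g k (y, t)" for y t k
    unfolding net[rule_format, OF P] sa_drift_def
    by (simp add: vec_eq_iff hadamard_def relu_vec_def matrix_vector_mul_component inner_prod_def
        mult.commute)
  then show ?thesis
    unfolding P_def by (intro exI[of _ "Suc (sum N UNIV)"] conjI exI) auto
qed

lemma sa_drift_uniform_approximation:
  fixes F :: "real ^ 'd \<Rightarrow> real \<Rightarrow> real ^ 'd"
  assumes S: "compact S" and F: "continuous_on S (\<lambda>(y, t). F y t)" and \<delta>: "\<delta> > 0"
  shows "\<exists>P\<ge>1. \<exists>W A1 A2 B. \<forall>y t. (y, t) \<in> S \<longrightarrow> norm (F y t - sa_drift P W A1 A2 B y t) \<le> \<delta>"
proof -
  \<comment> \<open>The Euclidean norm is at most the sum of the absolute components, so each
    component may err by an equal share of \<delta>.\<close>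
  have e: "\<delta> / real CARD('d) > 0" using \<delta> by simp
  have "\<forall>k. \<exists>g. g \<in> relu_nets \<and> (\<forall>p\<in>S. norm ((case p of (y, t) \<Rightarrow> F y t) $ k - g p) \<le> \<delta> / real CARD('d))"
  proof
    fix k
    have "relu_approximable S (\<lambda>p. (case p of (y, t) \<Rightarrow> F y t) $ k)"
      by (intro relu_universal_approximation S continuous_on_component F)
    then show "\<exists>g. g \<in> relu_nets \<and> (\<forall>p\<in>S. norm ((case p of (y, t) \<Rightarrow> F y t) $ k - g p) \<le> \<delta> / real CARD('d))"
      using e unfolding relu_approximable_def Bex_def by simp
  qed
  then obtain g where g: "\<forall>k. g k \<in> relu_nets \<and> (\<forall>p\<in>S. norm ((case p of (y, t) \<Rightarrow> F y t) $ k - g k p) \<le> \<delta> / real CARD('d))"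
    by (rule exE[OF choice])
  obtain P W A1 A2 B where P: "P \<ge> 1" and net: "\<forall>y t k. sa_drift P W A1 A2 B y t $ k = g k (y, t)"
    using ex_sa_drift_components[of g] g by blast
  have "norm (F y t - sa_drift P W A1 A2 B y t) \<le> \<delta>" if "(y, t) \<in> S" for y t
  proof -
    have "norm (F y t - sa_drift P W A1 A2 B y t) \<le> (\<Sum>k\<in>UNIV. \<bar>(F y t - sa_drift P W A1 A2 B y t) $ k\<bar>)"
      by (rule norm_le_l1_cart)
    also have "\<dots> \<le> (\<Sum>k\<in>(UNIV :: 'd set). \<delta> / real CARD('d))"
      using g that net by (intro sum_mono) fastforce
    also have "\<dots> = \<delta>" by simp
    finally show ?thesis .
  qed
  then show ?thesis
    using P by (intro exI[of _ P] conjI exI allI impI)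
qed

text \<open>Every entry is bounded by the operator norm. This transfers the Lipschitz hypothesis on
  the matrix field to its rows, for which the networks are constructed.\<close>

lemma norm_row_le_op_norm:
  fixes A :: "real ^ 'm ^ 'd"
  shows "norm (A $ k) \<le> real CARD('m) * op_norm A"
proof -
  have "norm (A $ k) \<le> (\<Sum>l\<in>UNIV. \<bar>A $ k $ l\<bar>)" by (rule norm_le_l1_cart)
  also have "\<dots> \<le> (\<Sum>l\<in>(UNIV :: 'm set). op_norm A)"
    unfolding op_norm_def by (intro sum_mono matrix_component_le_onorm)
  finally show ?thesis by simp
qed

lemma norm_mult_vector_le_op_norm: "norm (A *v x) \<le> op_norm A * norm x"
  unfolding op_norm_def by (rule onorm[OF matrix_vector_mul_bounded_linear])

lemma sa_control_uniform_approximation: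
  fixes F :: "real ^ 'd \<Rightarrow> real \<Rightarrow> real ^ 'm ^ 'd"
  assumes S: "compact S" and F: "\<And>k. continuous_on S (\<lambda>(y, t). F y t $ k)" and \<delta>: "\<delta> > 0"
  shows "\<exists>Q\<ge>1. \<exists>W A1 A2 B. \<forall>y t. (y, t) \<in> S \<longrightarrow> op_norm (F y t - sa_control Q W A1 A2 B y t) \<le> \<delta>"
proof -
  \<comment> \<open>The operator norm is at most the number of entries times a bound on the
    entries.\<close>
  define e where "e = \<delta> / (real CARD('d) * real CARD('m))"
  have e: "e > 0" using \<delta> by (simp add: e_def)
  have "\<forall>k. \<exists>g. g \<in> relu_nets \<and> (\<forall>p\<in>S. norm ((case p of (y, t) \<Rightarrow> F y t $ k) - g p) \<le> e)"
  proof
    fix k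
    have "relu_approximable S (\<lambda>p. (case p of (y, t) \<Rightarrow> F y t $ k))"
      by (intro relu_universal_approximation S F)
    then show "\<exists>g. g \<in> relu_nets \<and> (\<forall>p\<in>S. norm ((case p of (y, t) \<Rightarrow> F y t $ k) - g p) \<le> e)"
      using e unfolding relu_approximable_def Bex_def by simp
  qed
  then obtain g where g: "\<forall>k. g k \<in> relu_nets \<and> (\<forall>p\<in>S. norm ((case p of (y, t) \<Rightarrow> F y t $ k) - g k p) \<le> e)"
    by (rule exE[OF choice])
  obtain Q W A1 A2 B where Q: "Q \<ge> 1" and net: "\<forall>y t k. sa_control Q W A1 A2 B y t $ k = g k (y, t)"
    using ex_sa_control_components[of g] g by blast
  have "op_norm (F y t - sa_control Q W A1 A2 B y t) \<le> \<delta>" if "(y, t) \<in> S" for y t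
  proof -
    have "\<bar>(F y t - sa_control Q W A1 A2 B y t) $ k $ l\<bar> \<le> e" for k l
    proof -
      have "\<bar>(F y t - sa_control Q W A1 A2 B y t) $ k $ l\<bar> \<le> norm ((F y t - sa_control Q W A1 A2 B y t) $ k)"
        by (rule component_le_norm_cart)
      also have "\<dots> \<le> e" using g that net by fastforce
      finally show ?thesis .
    qed
    then have "op_norm (F y t - sa_control Q W A1 A2 B y t) \<le> real CARD('d) * real CARD('m) * e"
      unfolding op_norm_def by (rule onorm_le_matrix_component)
    also have "\<dots> = \<delta>" by (simp add: e_def)
    finally show ?thesis .
  qed
  then show ?thesis
    using Q by (intro exI[of _ Q] conjI exI allI impI)
qed

section \<open>Comparison of solutions\<close>

lemma AE_lebesgue_on_negligible:
  fixes a b :: real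
  assumes "AE t in lebesgue_on {a..b}. Q t"
  obtains N where "negligible N" "\<And>t. t \<in> {a..b} - N \<Longrightarrow> Q t"
proof -
  obtain N where N: "\<And>t. t \<in> space (lebesgue_on {a..b}) - N \<Longrightarrow> Q t" "N \<in> null_sets (lebesgue_on {a..b})"
    by (rule AE_E3[OF assms]) blast
  have "N \<in> null_sets lebesgue"
    using N(2) null_sets_restrict_space[of "{a..b}" lebesgue N] by auto
  then have "negligible N" by (simp add: negligible_iff_null_sets)
  then show thesis
    using N(1) by (intro that) auto
qed

lemma admissible_controls_bound:
  assumes "u \<in> admissible_controls T M"
  shows "AE t in lebesgue_on {0..T}. norm (u t) \<le> M"
proof -
  have "AE t in lebesgue_on {0..T}. ereal (norm (u t)) \<le> esssup (lebesgue_on {0..T}) (\<lambda>t. ereal (norm (u t)))"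
    by (rule esssup_AE)
  moreover have "esssup (lebesgue_on {0..T}) (\<lambda>t. ereal (norm (u t))) \<le> ereal M"
    using assms by (simp add: admissible_controls_def)
  ultimately show ?thesis
    by (auto elim!: eventually_mono dest: order_trans)
qed

lemma is_solution_negligible:
  assumes "is_solution f G T u z0 z" "u \<in> admissible_controls T M"
  obtains N where "negligible N"
    "\<And>t. t \<in> {0..T} - N \<Longrightarrow> (z has_vector_derivative f (z t) t + G (z t) t *v u t) (at t within {0..T})"
    "\<And>t. t \<in> {0..T} - N \<Longrightarrow> norm (u t) \<le> M"
proof -
  have "AE t in lebesgue_on {0..T}.
      (z has_vector_derivative f (z t) t + G (z t) t *v u t) (at t within {0..T})"
    using assms(1) by (simp add: is_solution_def)
  then obtain N1 where N1: "negligible N1"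
    "\<And>t. t \<in> {0..T} - N1 \<Longrightarrow> (z has_vector_derivative f (z t) t + G (z t) t *v u t) (at t within {0..T})"
    by (rule AE_lebesgue_on_negligible) blast
  obtain N2 where N2: "negligible N2" "\<And>t. t \<in> {0..T} - N2 \<Longrightarrow> norm (u t) \<le> M"
    using admissible_controls_bound[OF assms(2)] by (rule AE_lebesgue_on_negligible) blast
  show thesis
    by (rule that[of "N1 \<union> N2"]) (use N1 N2 in auto)
qed

text \<open>Comparison with the origin shows linear growth: the right-hand side is at most
  \<open>(L\<^sub>f + L\<^sub>G * M) * norm (z t) + C * (1 + M)\<close> almost everywhere, and
  Gronwall applies.\<close>

lemma solution_a_priori_bound:
  assumes sol: "is_solution f G T u z0 z" and u: "u \<in> admissible_controls T M"
    and pos: "M > 0" "L\<^sub>f > 0" "L\<^sub>G > 0"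
    and f: "\<And>x y t. t \<in> {0..T} \<Longrightarrow> norm (f x t - f y t) \<le> L\<^sub>f * norm (x - y)"
    and G: "\<And>x y t. t \<in> {0..T} \<Longrightarrow> op_norm (G x t - G y t) \<le> L\<^sub>G * norm (x - y)"
    and f0: "\<And>t. t \<in> {0..T} \<Longrightarrow> norm (f 0 t) \<le> C" and G0: "\<And>t. t \<in> {0..T} \<Longrightarrow> op_norm (G 0 t) \<le> C"
    and C: "C \<ge> 0" and t: "t \<in> {0..T}"
  shows "norm (z t) \<le> (norm z0 + C * (1 + M) / (L\<^sub>f + L\<^sub>G * M)) * exp ((L\<^sub>f + L\<^sub>G * M) * t)"
proof -
  obtain N where N: "negligible N"
    "\<And>t. t \<in> {0..T} - N \<Longrightarrow> (z has_vector_derivative f (z t) t + G (z t) t *v u t) (at t within {0..T})"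
    "\<And>t. t \<in> {0..T} - N \<Longrightarrow> norm (u t) \<le> M"
    by (rule is_solution_negligible[OF sol u]) blast
  have "z 0 = z0" "abs_continuous_on 0 T z" using sol by (auto simp: is_solution_def)
  have "norm (z t) \<le> (norm (z 0) + C * (1 + M) / (L\<^sub>f + L\<^sub>G * M)) * exp ((L\<^sub>f + L\<^sub>G * M) * t)"
  proof (rule gronwall_abs_continuous[OF \<open>abs_continuous_on 0 T z\<close> N(1)])
    fix t assume tN: "t \<in> {0..T} - N"
    then have t: "t \<in> {0..T}" by blast
    have "norm (f (z t) t) \<le> L\<^sub>f * norm (z t) + C"
      using f[OF t, of "z t" 0] f0[OF t] norm_triangle_ineq2[of "f (z t) t" "f 0 t"] by simp
    moreover have "norm (G (z t) t *v u t) \<le> (L\<^sub>G * norm (z t) + C) * M"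
    proof -
      have "G (z t) t *v u t = (G (z t) t - G 0 t) *v u t + G 0 t *v u t"
        by (simp add: matrix_vector_mult_diff_rdistrib)
      then have "norm (G (z t) t *v u t) \<le> norm ((G (z t) t - G 0 t) *v u t) + norm (G 0 t *v u t)"
        by (simp only: norm_triangle_ineq)
      also have "\<dots> \<le> op_norm (G (z t) t - G 0 t) * norm (u t) + op_norm (G 0 t) * norm (u t)"
        by (intro add_mono norm_mult_vector_le_op_norm)
      also have "\<dots> \<le> (L\<^sub>G * norm (z t)) * M + C * M"
        using G[OF t, of "z t" 0] G0[OF t] N(3)[OF tN] C pos by (intro add_mono mult_mono) auto
      finally show ?thesis by (simp add: algebra_simps)
    qed
    ultimately have "norm (f (z t) t + G (z t) t *v u t) \<le> (L\<^sub>f + L\<^sub>G * M) * norm (z t) + C * (1 + M)"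
      using norm_triangle_ineq[of "f (z t) t" "G (z t) t *v u t"] by (simp add: algebra_simps)
    with N(2)[OF tN] show "\<exists>w'. (z has_vector_derivative w') (at t within {0..T}) \<and>
        norm w' \<le> (L\<^sub>f + L\<^sub>G * M) * norm (z t) + C * (1 + M)" by blast
  qed (use pos C t in \<open>auto intro: add_pos_pos\<close>)
  then show ?thesis by (simp add: \<open>z 0 = z0\<close>)
qed

lemma solution_comparison:
  assumes z: "is_solution f G T u z0 z" and y: "is_solution g H T u z0 y"
    and u: "u \<in> admissible_controls T M"
    and pos: "M > 0" "L\<^sub>f > 0" "L\<^sub>G > 0" "\<delta> > 0"
    and f: "\<And>x y t. t \<in> {0..T} \<Longrightarrow> norm (f x t - f y t) \<le> L\<^sub>f * norm (x - y)"
    and G: "\<And>x y t. t \<in> {0..T} \<Longrightarrow> op_norm (G x t - G y t) \<le> L\<^sub>G * norm (x - y)"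
    and g: "\<And>x t. norm x \<le> R + 1 \<Longrightarrow> t \<in> {0..T} \<Longrightarrow> norm (f x t - g x t) \<le> \<delta>"
    and H: "\<And>x t. norm x \<le> R + 1 \<Longrightarrow> t \<in> {0..T} \<Longrightarrow> op_norm (G x t - H x t) \<le> \<delta>"
    and R: "\<And>t. t \<in> {0..T} \<Longrightarrow> norm (z t) \<le> R"
    and \<eta>: "\<delta> * (1 + M) / (L\<^sub>f + L\<^sub>G * M) * exp ((L\<^sub>f + L\<^sub>G * M) * T) = \<eta>" "\<eta> < 1"
    and t: "t \<in> {0..T}"
  shows "norm (z t - y t) \<le> \<eta>"
proof -
  define L where "L = L\<^sub>f + L\<^sub>G * M"
  have L: "L > 0" using pos by (simp add: L_def add_pos_pos)
  obtain N1 where N1: "negligible N1"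
    "\<And>t. t \<in> {0..T} - N1 \<Longrightarrow> (z has_vector_derivative f (z t) t + G (z t) t *v u t) (at t within {0..T})"
    "\<And>t. t \<in> {0..T} - N1 \<Longrightarrow> norm (u t) \<le> M"
    by (rule is_solution_negligible[OF z u]) blast
  obtain N2 where N2: "negligible N2"
    "\<And>t. t \<in> {0..T} - N2 \<Longrightarrow> (y has_vector_derivative g (y t) t + H (y t) t *v u t) (at t within {0..T})"
    by (rule is_solution_negligible[OF y u]) blast
  define w where "w t = z t - y t" for t
  have w0: "w 0 = 0" and ac: "abs_continuous_on 0 T w"
    using z y abs_continuous_on_diff unfolding w_def is_solution_def by auto
  \<comment> \<open>The bound 1 before time \<open>s\<close> improves to \<eta> up to and including
    \<open>s\<close>.\<close>
  have up_to_exit: "norm (w t) \<le> \<eta>" if s: "s \<in> {0..T}" and le1: "\<And>t. 0 \<le> t \<Longrightarrow> t < s \<Longrightarrow> norm (w t) \<le> 1"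
    and t: "t \<in> {0..s}" for s t
  proof -
    have sub: "{0..s} \<subseteq> {0..T}" using s by auto
    have "norm (w t) \<le> (norm (w 0) + \<delta> * (1 + M) / L) * exp (L * t)"
    \<comment> \<open>At \<open>s\<close> itself nothing is known about \<open>w\<close> yet, so
      \<open>s\<close> is added to the exceptional null set.\<close>
    proof (rule gronwall_abs_continuous[of s w "insert s (N1 \<union> N2)"])
      fix t assume tN: "t \<in> {0..s} - insert s (N1 \<union> N2)"
      then have t: "t \<in> {0..T}" and t1: "t \<in> {0..T} - N1" and t2: "t \<in> {0..T} - N2" using sub by auto
      have "norm (w t) \<le> 1" using le1[of t] tN by auto
      then have y_le: "norm (y t) \<le> R + 1"
        using R[OF t] norm_triangle_ineq2[of "y t" "z t"] by (simp add: w_def norm_minus_commute)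
      define D where "D = (f (z t) t + G (z t) t *v u t) - (g (y t) t + H (y t) t *v u t)"
      have D: "(w has_vector_derivative D) (at t within {0..s})"
        unfolding w_def D_def
        by (rule has_vector_derivative_within_subset[OF has_vector_derivative_diff[OF N1(2)[OF t1] N2(2)[OF t2]] sub])
      \<comment> \<open>The mixed terms at \<open>y t\<close> split off the Lipschitz differences of
        \<open>f\<close> and \<open>G\<close> from the approximation errors, which are evaluated at
        \<open>y t\<close> and hence in the larger ball.\<close>
      have "D = ((f (z t) t - f (y t) t) + (f (y t) t - g (y t) t))
          + ((G (z t) t - G (y t) t) *v u t + (G (y t) t - H (y t) t) *v u t)"
        by (simp add: D_def matrix_vector_mult_diff_rdistrib)
      then have "norm D \<le> (norm (f (z t) t - f (y t) t) + norm (f (y t) t - g (y t) t))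
          + (norm ((G (z t) t - G (y t) t) *v u t) + norm ((G (y t) t - H (y t) t) *v u t))"
        by (metis add_mono norm_triangle_mono norm_triangle_ineq)
      also have "\<dots> \<le> (L\<^sub>f * norm (w t) + \<delta>) + ((L\<^sub>G * norm (w t)) * M + \<delta> * M)"
      proof (intro add_mono)
        show "norm (f (z t) t - f (y t) t) \<le> L\<^sub>f * norm (w t)" unfolding w_def by (rule f[OF t])
        show "norm (f (y t) t - g (y t) t) \<le> \<delta>" by (rule g[OF y_le t])
        have "op_norm (G (z t) t - G (y t) t) * norm (u t) \<le> (L\<^sub>G * norm (w t)) * M"
          using G[OF t, of "z t" "y t"] N1(3)[OF t1] pos unfolding w_def by (intro mult_mono) auto
        then show "norm ((G (z t) t - G (y t) t) *v u t) \<le> (L\<^sub>G * norm (w t)) * M"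
          by (rule order_trans[OF norm_mult_vector_le_op_norm])
        have "op_norm (G (y t) t - H (y t) t) * norm (u t) \<le> \<delta> * M"
          using H[OF y_le t] N1(3)[OF t1] pos by (intro mult_mono) auto
        then show "norm ((G (y t) t - H (y t) t) *v u t) \<le> \<delta> * M"
          by (rule order_trans[OF norm_mult_vector_le_op_norm])
      qed
      also have "\<dots> = L * norm (w t) + \<delta> * (1 + M)"
        by (simp add: L_def algebra_simps)
      finally show "\<exists>w'. (w has_vector_derivative w') (at t within {0..s}) \<and>
          norm w' \<le> L * norm (w t) + \<delta> * (1 + M)"
        using D by blast
    qed (use ac s t L pos N1(1) N2(1) in \<open>auto intro: abs_continuous_on_subinterval\<close>)
    also have "\<dots> \<le> \<delta> * (1 + M) / L * exp (L * T)"
    proof -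
      have "L * t \<le> L * T" using t s L by (intro mult_left_mono) auto
      moreover have "\<delta> * (1 + M) / L \<ge> 0" using L pos by simp
      ultimately show ?thesis unfolding w0 norm_zero add_0
        by (intro mult_left_mono) (simp_all only: exp_le_cancel_iff)
    qed
    also have "\<dots> = \<eta>" using \<eta>(1) by (simp add: L_def)
    finally show ?thesis .
  qed
  have lt1: "norm (w t) < 1" if "t \<in> {0..T}" for t
  proof (rule ccontr)
    assume "\<not> norm (w t) < 1"
    \<comment> \<open>By continuity of \<open>w\<close> this set is closed, so it has a smallest
      element, the first exit time. There \<open>up_to_exit\<close> gives a norm of at most
      \<open>\<eta> < 1\<close>, a contradiction.\<close>
    define E where "E = {0..T} \<inter> (\<lambda>t. norm (w t)) -` {1..}"
    have "closed E"
      unfolding E_def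
      by (intro continuous_closed_preimage continuous_on_norm abs_continuous_on_imp_continuous_on[OF ac]) auto
    moreover have "E \<subseteq> {0..T}" by (auto simp: E_def)
    ultimately have "compact E"
      using compact_Int_closed[of "{0..T}" E] by (simp add: Int_absorb1)
    moreover have "E \<noteq> {}" using that \<open>\<not> norm (w t) < 1\<close> by (auto simp: E_def)
    ultimately obtain s where s: "s \<in> E" "\<forall>r\<in>E. s \<le> r"
      using compact_attains_inf by blast
    have "norm (w s) \<le> \<eta>"
    proof (rule up_to_exit)
      show "norm (w r) \<le> 1" if "0 \<le> r" "r < s" for r
        using s that by (force simp: E_def)
    qed (use s in \<open>auto simp: E_def\<close>)
    then show False using \<eta>(2) s(1) by (simp add: E_def)
  qed
  show ?thesis
    unfolding w_def[symmetric]
    by (rule up_to_exit[of T]) (use lt1 t in \<open>auto simp: less_imp_le\<close>)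
qed

theorem theorem4p6:
  fixes f :: "real ^ 'd \<Rightarrow> real \<Rightarrow> real ^ 'd"
    and G :: "real ^ 'd \<Rightarrow> real \<Rightarrow> real ^ 'm ^ 'd"
    and T M L\<^sub>f L\<^sub>G \<epsilon> :: real
    and K :: "(real ^ 'd) set"
  assumes "T > 0" and "M > 0" and "L\<^sub>f > 0" and "L\<^sub>G > 0"
    and "\<And>x. continuous_on {0..T} (\<lambda>t. f x t)"
    and "\<And>x. continuous_on {0..T} (\<lambda>t. G x t)"
    and "\<And>x y t. t \<in> {0..T} \<Longrightarrow> norm (f x t - f y t) \<le> L\<^sub>f * norm (x - y)"
    and "\<And>x y t. t \<in> {0..T} \<Longrightarrow> op_norm (G x t - G y t) \<le> L\<^sub>G * norm (x - y)"
    and "compact K"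
    and "\<epsilon> > 0"
  shows "\<exists>(P::nat) (Q::nat)
            (W :: nat \<Rightarrow> real ^ 'd) (A1 :: nat \<Rightarrow> real ^ 'd ^ 'd)
            (A2 :: nat \<Rightarrow> real ^ 'd) (B :: nat \<Rightarrow> real ^ 'd)
            (W' :: nat \<Rightarrow> real ^ 'm ^ 'd) (A1' :: nat \<Rightarrow> real ^ 'd ^ 'd)
            (A2' :: nat \<Rightarrow> real ^ 'd) (B' :: nat \<Rightarrow> real ^ 'd).
           P \<ge> 1 \<and> Q \<ge> 1 \<and>
           (\<forall>z0 \<in> K. \<forall>u \<in> admissible_controls T M. \<forall>z y.
              is_solution f G T u z0 z \<longrightarrow>
              is_solution (sa_drift P W A1 A2 B) (sa_control Q W' A1' A2' B') T u z0 y \<longrightarrow>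
              (SUP t\<in>{0..T}. norm (z t - y t)) \<le> \<epsilon>)"
proof -
  define L where "L = L\<^sub>f + L\<^sub>G * M"
  have L: "L > 0" using assms(2-4) by (simp add: L_def add_pos_pos)
  obtain C1 where C1: "\<forall>t\<in>{0..T}. norm (f 0 t) \<le> C1"
    using compact_imp_bounded[OF compact_continuous_image[OF assms(5)[of 0]]] by (auto simp: bounded_iff)
  obtain C2 where C2: "\<forall>t\<in>{0..T}. norm (G 0 t) \<le> C2"
    using compact_imp_bounded[OF compact_continuous_image[OF assms(6)[of 0]]] by (auto simp: bounded_iff)
  \<comment> \<open>Continuity of \<open>G\<close> bounds its Frobenius norm; the operator norm is
    reached through the entries.\<close>
  have op_le: "op_norm (G 0 t) \<le> real CARD('d) * real CARD('m) * C2" if "t \<in> {0..T}" for t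
    unfolding op_norm_def
  proof (rule onorm_le_matrix_component)
    fix k l
    have "\<bar>G 0 t $ k $ l\<bar> \<le> norm (G 0 t $ k)" by (rule component_le_norm_cart)
    also have "\<dots> \<le> norm (G 0 t)" by (rule Finite_Cartesian_Product.norm_nth_le)
    also have "\<dots> \<le> C2" using C2 that by blast
    finally show "\<bar>G 0 t $ k $ l\<bar> \<le> C2" .
  qed
  define C where "C = max \<bar>C1\<bar> (real CARD('d) * real CARD('m) * C2)"
  have C: "C \<ge> 0" "\<And>t. t \<in> {0..T} \<Longrightarrow> norm (f 0 t) \<le> C" "\<And>t. t \<in> {0..T} \<Longrightarrow> op_norm (G 0 t) \<le> C"
    using C1 op_le by (fastforce simp: C_def)+
  obtain r where r: "\<forall>x\<in>K. norm x \<le> r"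
    using compact_imp_bounded[OF assms(9)] by (auto simp: bounded_iff)
  \<comment> \<open>The a priori bound at its worst: initial norm \<open>r\<close> and time
    \<open>T\<close>.\<close>
  define R where "R = (r + C * (1 + M) / L) * exp (L * T)"
  \<comment> \<open>The factor by which Gronwall amplifies an error in the fields.\<close>
  define c where "c = (1 + M) / L * exp (L * T)"
  have c: "c > 0" using L assms(2) by (simp add: c_def)
  \<comment> \<open>The cap 1/2 keeps the error below the margin 1 between the two balls, also for
    large \<epsilon>.\<close>
  define \<eta> where "\<eta> = min \<epsilon> (1/2)"
  have \<eta>: "\<eta> > 0" "\<eta> < 1" "\<eta> \<le> \<epsilon>" using assms(10) by (auto simp: \<eta>_def)
  define \<delta> where "\<delta> = \<eta> / c"
  have \<delta>: "\<delta> > 0" "\<delta> * (1 + M) / L * exp (L * T) = \<eta>"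
  proof -
    show "\<delta> > 0" using c \<eta>(1) by (simp add: \<delta>_def)
    have "\<delta> * (1 + M) / L * exp (L * T) = \<delta> * c" by (simp add: c_def)
    also have "\<dots> = \<eta>" using c by (simp add: \<delta>_def)
    finally show "\<delta> * (1 + M) / L * exp (L * T) = \<eta>" .
  qed
  define S where "S = cball (0 :: real ^ 'd) (R + 1) \<times> {0..T}"
  have S: "compact S" "S \<subseteq> UNIV \<times> {0..T}"
    by (auto simp: S_def intro: compact_Times)
  have "continuous_on S (\<lambda>(y, t). f y t)"
    by (rule continuous_on_subset[OF continuous_on_Times_lipschitz[OF assms(5,3,7)] S(2)])
  from sa_drift_uniform_approximation[OF S(1) this \<delta>(1)]
  obtain P W A1 A2 B where P: "P \<ge> 1"
    and drift: "\<forall>y t. (y, t) \<in> S \<longrightarrow> norm (f y t - sa_drift P W A1 A2 B y t) \<le> \<delta>"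
    by blast
  have "continuous_on S (\<lambda>(y, t). G y t $ k)" for k
  proof (rule continuous_on_subset[OF continuous_on_Times_lipschitz S(2)])
    show "continuous_on {0..T} (\<lambda>t. G x t $ k)" for x
      by (intro continuous_on_component assms(6))
    show "real CARD('m) * L\<^sub>G > 0" using assms(4) by simp
    show "norm (G x t $ k - G y t $ k) \<le> real CARD('m) * L\<^sub>G * norm (x - y)" if "t \<in> {0..T}" for x y t
    proof -
      have "norm (G x t $ k - G y t $ k) \<le> real CARD('m) * op_norm (G x t - G y t)"
        using norm_row_le_op_norm[of "G x t - G y t" k] by simp
      also have "\<dots> \<le> real CARD('m) * (L\<^sub>G * norm (x - y))"
        by (intro mult_left_mono assms(8) that) simp
      finally show ?thesis by (simp add: mult.assoc)
    qed
  qed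
  from sa_control_uniform_approximation[OF S(1) this \<delta>(1)]
  obtain Q W' A1' A2' B' where Q: "Q \<ge> 1"
    and control: "\<forall>y t. (y, t) \<in> S \<longrightarrow> op_norm (G y t - sa_control Q W' A1' A2' B' y t) \<le> \<delta>"
    by blast
  have "(SUP t\<in>{0..T}. norm (z t - y t)) \<le> \<epsilon>"
    if z0: "z0 \<in> K" and u: "u \<in> admissible_controls T M" and z: "is_solution f G T u z0 z"
      and y: "is_solution (sa_drift P W A1 A2 B) (sa_control Q W' A1' A2' B') T u z0 y" for z0 u z y
  proof (rule cSUP_least)
    show "{0..T} \<noteq> {}" using assms(1) by simp
    fix t assume t: "t \<in> {0..T}"
    have z_le: "norm (z t) \<le> R" if t: "t \<in> {0..T}" for t
    proof -
      have "norm (z t) \<le> (norm z0 + C * (1 + M) / L) * exp (L * t)"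
        unfolding L_def using z u assms(2,3,4,7,8) C(2,3,1) t by (rule solution_a_priori_bound)
      also have "\<dots> \<le> (r + C * (1 + M) / L) * exp (L * T)"
      proof (rule mult_mono)
        show "norm z0 + C * (1 + M) / L \<le> r + C * (1 + M) / L" using r z0 by simp
        show "exp (L * t) \<le> exp (L * T)" using t L by simp
        \<comment> \<open>Nonnegativity of \<open>r\<close> comes from the point \<open>z0\<close>;
          for empty \<open>K\<close> the choice of \<open>r\<close> would not imply it.\<close>
        have "r \<ge> 0" using r z0 norm_ge_zero order_trans by blast
        then show "0 \<le> r + C * (1 + M) / L" using C(1) L assms(2) by simp
      qed simp
      finally show ?thesis by (simp add: R_def)
    qed
    have "norm (z t - y t) \<le> \<eta>"
    proof (rule solution_comparison[OF z y u assms(2,3,4) \<delta>(1) assms(7,8) _ _ z_le \<delta>(2)[unfolded L_def] \<eta>(2) t])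
      show "norm (f x t - sa_drift P W A1 A2 B x t) \<le> \<delta>" if "norm x \<le> R + 1" "t \<in> {0..T}" for x t
        using drift that by (simp add: S_def)
      show "op_norm (G x t - sa_control Q W' A1' A2' B' x t) \<le> \<delta>" if "norm x \<le> R + 1" "t \<in> {0..T}" for x t
        using control that by (simp add: S_def)
    qed
    then show "norm (z t - y t) \<le> \<epsilon>" using \<eta>(3) by linarith
  qed
  then show ?thesis
    using P Q by (intro exI conjI ballI allI impI)
qed

end
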